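(* Let $R$ be a ring with $\frac1n\in R$, let $\delta:R\to R$ be an arbitrary endomorphism, and let $T=[t_{i,j}]$ be an $n\times n$ transitive matrix over $R$ such that the entries $t_{i,1}\in \mathrm{U}(R)\cap \mathrm{Z}(R)$, $1\le i\le n$, of the first column are central invertible elements. For $r\in R$ let $\overline{\delta}(r)=\frac1n[x_{i,j}(r)]_{n\times n}$ be the $n\times n$ matrix over $R$ whose $(i,j)$ entry is $\frac1n x_{i,j}(r)$, where $$x_{i,j}(r)=\sum_{k=0}^{n-1}t_{j,i}^{k}\,\delta^{k}(r)=\sum_{k=0}^{n-1}t_{i,j}^{-k}\,\delta^{k}(r).$$ This defines a map $\overline{\delta}:R\to \mathrm{M}_n(R)$ such that $\overline{\delta}(cr)=c\,\overline{\delta}(r)$ and $\overline{\delta}(rc)=\overline{\delta}(r)\,c$ for all $r\in R$ and $c\in\mathrm{Fix}(\delta)$. Moreover: (1) If $t_{i,1}^{n}=1$ for all $1\le i\le n$ and $1-t_{i,j}$ is a non-zero divisor in $\mathrm{Z}(R)$ for all $1\le i,j\le n$ with $i\ne j$, then $\overline{\delta}(r)=rI_n$ is a scalar matrix for any $r\in \mathrm{Fix}(\delta)$. (2) If $t_{1,1}^{k}+t_{2,1}^{k}+\cdots+t_{n,1}^{k}=t_{1,1}^{-k}+t_{2,1}^{-k}+\cdots+t_{n,1}^{-k}=0$ for all $1\le k\le n-1$, then $\overline{\delta}:R\to \mathrm{M}_n(R)$ is an embedding of rings. (3) If $t_{i,1}\in\mathrm{Fix}(\delta)$ and $t_{i,1}^{n}=1$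 for all $1\le i\le n$, and $\delta^{n}=\mathrm{id}_R$, then $\overline{\delta}$ is an $R\to \mathrm{M}_n(R,\delta,T)$ embedding.
   Context: A ring means a not necessarily commutative ring with identity; subrings inherit and endomorphisms preserve the identity. $\mathrm{U}(R)$ is the group of units of $R$, $\mathrm{Z}(R)$ its center, $\mathrm{M}_n(R)$ the ring of $n\times n$ matrices over $R$, $I_n$ the identity matrix, and $\mathrm{Fix}(\delta)=\{r\in R\mid \delta(r)=r\}$. The condition $\frac1n\in R$ means that $n\cdot 1$ is invertible in $R$. For a matrix $X$ over $R$ and $c\in R$, $cX$ and $Xc$ denote entrywise left and right multiplication by $c$. A matrix $T=[t_{i,j}]\in\mathrm{M}_n(R)$ is transitive if $t_{i,i}=1$ and $t_{i,j}t_{j,k}=t_{i,k}$ for all $i,j,k\in\{1,\ldots,n\}$ (so $t_{j,i}=t_{i,j}^{-1}$; if the first column consists of central units then all entries $t_{i,j}=t_{i,1}t_{j,1}^{-1}$ are central units). For an endomorphism $\delta$ of $R$ and a transitive $T\in \mathrm{M}_n(\mathrm{Z}(R))$, the supermatrix algebra is the subring $$\mathrm{M}_n(R,\delta,T)=\{A=[a_{i,j}]\in\mathrm{M}_n(R)\mid \delta(a_{i,j})=t_{i,j}a_{i,j}\text{ for all }1\le i,j\le n\}.$$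
   Formalization: In (3) the embedding is claimed only if the power sums in (2) also vanish; without this only the image in M_n(R,δ,T) is claimed. Alone, (3) fails: R=ℂ, n=2, δ conjugation, T all ones gives δ̄(i)=0. *)

theory Defs
  imports "HOL-Algebra.RingHom"
begin

definition ring_center :: "('a, 'm) ring_scheme \<Rightarrow> 'a set"
  where "ring_center R = {z \<in> carrier R. \<forall>r \<in> carrier R. z \<otimes>\<^bsub>R\<^esub> r = r \<otimes>\<^bsub>R\<^esub> z}"

definition Fix :: "('a, 'm) ring_scheme \<Rightarrow> ('a \<Rightarrow> 'a) \<Rightarrow> 'a set"
  where "Fix R \<delta> = {r \<in> carrier R. \<delta> r = r}"

definition non_zero_divisor :: "('a, 'm) ring_scheme \<Rightarrow> 'a \<Rightarrow> bool"
  where "non_zero_divisor S z \<longleftrightarrow> z \<in> carrier S \<and>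
    (\<forall>w \<in> carrier S. (z \<otimes>\<^bsub>S\<^esub> w = \<zero>\<^bsub>S\<^esub> \<or> w \<otimes>\<^bsub>S\<^esub> z = \<zero>\<^bsub>S\<^esub>) \<longrightarrow> w = \<zero>\<^bsub>S\<^esub>)"

text \<open>Entries are indexed by \<open>{1..n}\<close>. Matrices are extensional functions, undefined outside this
  index range, so that equality of matrices is equality of their entries.\<close>

definition mk_mat :: "nat \<Rightarrow> (nat \<Rightarrow> nat \<Rightarrow> 'a) \<Rightarrow> nat \<Rightarrow> nat \<Rightarrow> 'a"
  where "mk_mat n f = (\<lambda>i \<in> {1..n}. \<lambda>j \<in> {1..n}. f i j)"

definition mat_ring :: "nat \<Rightarrow> ('a, 'm) ring_scheme \<Rightarrow> (nat \<Rightarrow> nat \<Rightarrow> 'a) ring"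
  where "mat_ring n R =
    \<lparr> carrier = {1..n} \<rightarrow>\<^sub>E ({1..n} \<rightarrow>\<^sub>E carrier R),
      mult = (\<lambda>A B. mk_mat n (\<lambda>i j. \<Oplus>\<^bsub>R\<^esub>k \<in> {1..n}. A i k \<otimes>\<^bsub>R\<^esub> B k j)),
      one = mk_mat n (\<lambda>i j. if i = j then \<one>\<^bsub>R\<^esub> else \<zero>\<^bsub>R\<^esub>),
      zero = mk_mat n (\<lambda>i j. \<zero>\<^bsub>R\<^esub>),
      add = (\<lambda>A B. mk_mat n (\<lambda>i j. A i j \<oplus>\<^bsub>R\<^esub> B i j)) \<rparr>"

definition mat_lmult :: "nat \<Rightarrow> ('a, 'm) ring_scheme \<Rightarrow> 'a \<Rightarrow> (nat \<Rightarrow> nat \<Rightarrow> 'a) \<Rightarrow> nat \<Rightarrow> nat \<Rightarrow> 'a"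
  where "mat_lmult n R c X = mk_mat n (\<lambda>i j. c \<otimes>\<^bsub>R\<^esub> X i j)"

definition mat_rmult :: "nat \<Rightarrow> ('a, 'm) ring_scheme \<Rightarrow> (nat \<Rightarrow> nat \<Rightarrow> 'a) \<Rightarrow> 'a \<Rightarrow> nat \<Rightarrow> nat \<Rightarrow> 'a"
  where "mat_rmult n R X c = mk_mat n (\<lambda>i j. X i j \<otimes>\<^bsub>R\<^esub> c)"

definition transitive_mat :: "nat \<Rightarrow> ('a, 'm) ring_scheme \<Rightarrow> (nat \<Rightarrow> nat \<Rightarrow> 'a) \<Rightarrow> bool"
  where "transitive_mat n R T \<longleftrightarrow> T \<in> carrier (mat_ring n R) \<and>
    (\<forall>i \<in> {1..n}. T i i = \<one>\<^bsub>R\<^esub>) \<and>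
    (\<forall>i \<in> {1..n}. \<forall>j \<in> {1..n}. \<forall>k \<in> {1..n}. T i j \<otimes>\<^bsub>R\<^esub> T j k = T i k)"

definition supermatrix_algebra ::
    "nat \<Rightarrow> ('a, 'm) ring_scheme \<Rightarrow> ('a \<Rightarrow> 'a) \<Rightarrow> (nat \<Rightarrow> nat \<Rightarrow> 'a) \<Rightarrow> (nat \<Rightarrow> nat \<Rightarrow> 'a) ring"
  where "supermatrix_algebra n R \<delta> T = (mat_ring n R)
    \<lparr> carrier := {A \<in> carrier (mat_ring n R).
        \<forall>i \<in> {1..n}. \<forall>j \<in> {1..n}. \<delta> (A i j) = T i j \<otimes>\<^bsub>R\<^esub> A i j} \<rparr>"

text \<open>The locale predicate \<open>ring_hom_ring\<close> also asserts that both \<open>R\<close> and \<open>S\<close> are rings.\<close>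

definition ring_embedding ::
    "('a, 'm) ring_scheme \<Rightarrow> ('b, 'k) ring_scheme \<Rightarrow> ('a \<Rightarrow> 'b) \<Rightarrow> bool"
  where "ring_embedding R S f \<longleftrightarrow> ring_hom_ring R S f \<and> inj_on f (carrier R)"

text \<open>The element \<open>n \<cdot> 1\<close>. The hypothesis \<open>1/n \<in> R\<close> says that it is a unit.\<close>

definition nat_elt :: "('a, 'm) ring_scheme \<Rightarrow> nat \<Rightarrow> 'a"
  where "nat_elt R n = [n] \<cdot>\<^bsub>R\<^esub> \<one>\<^bsub>R\<^esub>"

text \<open>\<open>delta_sum n R \<delta> T r i j\<close> is the sum \<open>x\<^sub>i\<^sub>,\<^sub>j(r)\<close>; note the transposed index in \<open>T j i\<close>.\<close>

definition delta_sum :: "nat \<Rightarrow> ('a, 'm) ring_scheme \<Rightarrow> ('a \<Rightarrow> 'a) \<Rightarrow> (nat \<Rightarrow> nat \<Rightarrow> 'a)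
    \<Rightarrow> 'a \<Rightarrow> nat \<Rightarrow> nat \<Rightarrow> 'a"
  where "delta_sum n R \<delta> T r i j =
    (\<Oplus>\<^bsub>R\<^esub>k \<in> {0..n - 1}. (T j i [^]\<^bsub>R\<^esub> k) \<otimes>\<^bsub>R\<^esub> (\<delta> ^^ k) r)"

definition delta_bar :: "nat \<Rightarrow> ('a, 'm) ring_scheme \<Rightarrow> ('a \<Rightarrow> 'a) \<Rightarrow> (nat \<Rightarrow> nat \<Rightarrow> 'a)
    \<Rightarrow> 'a \<Rightarrow> nat \<Rightarrow> nat \<Rightarrow> 'a"
  where "delta_bar n R \<delta> T r =
    mk_mat n (\<lambda>i j. inv\<^bsub>R\<^esub> (nat_elt R n) \<otimes>\<^bsub>R\<^esub> delta_sum n R \<delta> T r i j)"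

text \<open>The power \<open>t\<^sup>-\<^sup>k\<close> of a unit is written as the \<open>k\<close>-th power of its inverse.\<close>

definition power_sums_vanish :: "nat \<Rightarrow> ('a, 'm) ring_scheme \<Rightarrow> (nat \<Rightarrow> nat \<Rightarrow> 'a) \<Rightarrow> bool"
  where "power_sums_vanish n R T \<longleftrightarrow> (\<forall>k \<in> {1..n - 1}.
    (\<Oplus>\<^bsub>R\<^esub>i \<in> {1..n}. T i 1 [^]\<^bsub>R\<^esub> k) = \<zero>\<^bsub>R\<^esub> \<and>
    (\<Oplus>\<^bsub>R\<^esub>i \<in> {1..n}. (inv\<^bsub>R\<^esub> (T i 1)) [^]\<^bsub>R\<^esub> k) = \<zero>\<^bsub>R\<^esub>)"

end

theory Submission
  imports Defs "HOL-Algebra.Subrings" "HOL-Algebra.UnivPoly" "HOL-Algebra.Divisibility"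
begin

text \<open>Write \<open>V\<close> and \<open>W\<close> for the matrices of the powers \<open>t\<^sub>i\<^sub>,\<^sub>1\<^sup>k\<close> and \<open>t\<^sub>i\<^sub>,\<^sub>1\<^sup>-\<^sup>k\<close>. If the power sums vanish then
  \<open>V W = n I\<close>, which collapses the double sum over \<open>\<delta>\<^sup>k(r) \<delta>\<^sup>l(s)\<close> in the product of the images of \<open>r\<close> and
  \<open>s\<close> to its diagonal and makes the map multiplicative. Summing the first row of the image of \<open>r\<close>
  recovers \<open>r\<close>, hence injectivity. The unit is preserved because \<open>V W = n I\<close> implies \<open>W V = n I\<close> over
  the center. In (1), the off-diagonal sums are killed by \<open>(1 - t) \<Sum>\<^sub>k t\<^sup>k = 1 - t\<^sup>n\<close>; in (3),
  applying \<open>\<delta>\<close> shifts the summation index cyclically, at the cost of a factor \<open>t\<^sub>i\<^sub>,\<^sub>j\<close>.\<close>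

section \<open>Finite sums: interchange, and passage to subrings\<close>

lemma (in abelian_monoid) finsum_swap:
  assumes "finite A" "finite B" "\<And>a b. a \<in> A \<Longrightarrow> b \<in> B \<Longrightarrow> f a b \<in> carrier G"
  shows "(\<Oplus>a\<in>A. \<Oplus>b\<in>B. f a b) = (\<Oplus>b\<in>B. \<Oplus>a\<in>A. f a b)"
  using assms(1,3)
proof (induction A rule: finite_induct)
  case empty
  then show ?case by simp
next
  case (insert x F)
  have "(\<Oplus>a\<in>insert x F. \<Oplus>b\<in>B. f a b) = (\<Oplus>b\<in>B. f x b) \<oplus> (\<Oplus>b\<in>B. \<Oplus>a\<in>F. f a b)"
    using insert by (simp add: Pi_def)
  also have "\<dots> = (\<Oplus>b\<in>B. f x b \<oplus> (\<Oplus>a\<in>F. f a b))"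
    using insert by (subst finsum_addf) (auto simp: Pi_def)
  also have "\<dots> = (\<Oplus>b\<in>B. \<Oplus>a\<in>insert x F. f a b)"
    using insert by (intro finsum_cong') (auto simp: Pi_def)
  finally show ?case .
qed

text \<open>\<open>finsum\<close> depends on the carrier, so sums in a subring and in
  \<open>R\<close> are formally different objects; both arise by the same insertions. For infinite
  \<open>A\<close> both are zero by convention.\<close>

lemma (in ring) finsum_subring:
  assumes "subring H R" "f \<in> A \<rightarrow> H"
  shows "finsum (R\<lparr>carrier := H\<rparr>) f A = finsum R f A"
proof -
  interpret H: ring "R\<lparr>carrier := H\<rparr>" using subring_is_ring[OF assms(1)] .
  have HR: "H \<subseteq> carrier R" using assms(1) subringE(1) by blast
  show ?thesis
  proof (cases "finite A")
    case True
    then show ?thesis using assms(2)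
    proof (induction A rule: finite_induct)
      case empty
      show ?case using H.finsum_empty by simp
    next
      case (insert x F)
      moreover have "f \<in> F \<rightarrow> carrier R" "f x \<in> carrier R" using insert HR by auto
      ultimately show ?case using H.finsum_insert[of F x f] by simp
    qed
  next
    case False
    then show ?thesis using H.finsum_infinite by simp
  qed
qed

section \<open>Vandermonde inversion without determinants\<close>

text \<open>Exponents are natural numbers with truncated subtraction, so the two signs of
  \<open>k - l\<close> are separated; in each case the larger power is split and the common part
  cancels.\<close>

lemma (in monoid) Units_pow_mult_inv_pow:
  assumes "t \<in> Units G"
  shows "t [^] (k::nat) \<otimes> inv t [^] (l::nat) = (if l \<le> k then t [^] (k - l) else inv t [^] (l - k))"
proof -
  have [simp]: "t [^] (l::nat) \<otimes> inv t [^] l = \<one>" for l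
    using assms
      by (metis Units_closed Units_inv_closed Units_l_inv Units_r_inv pow_mult_distrib nat_pow_one)
  show ?thesis
  proof (cases "l \<le> k")
    case True
    then have "t [^] k = t [^] (k - l) \<otimes> t [^] l"
      using assms by (simp add: nat_pow_mult Units_closed)
    then show ?thesis using True assms by (simp add: m_assoc Units_closed)
  next
    case False
    then have "inv t [^] l = inv t [^] k \<otimes> inv t [^] (l - k)"
      using assms by (simp add: nat_pow_mult Units_closed)
    then show ?thesis using False assms by (simp add: m_assoc[symmetric] Units_closed)
  qed
qed

text \<open>Telescoping geometric sum. Only powers of the single element \<open>t\<close> occur, so
  it holds in a noncommutative ring.\<close>

lemma (in ring) one_minus_mult_pow_sum:
  assumes "t \<in> carrier R"
  shows "(\<one> \<ominus> t) \<otimes> (\<Oplus>k\<in>{0..m}. t [^] (k::nat)) = \<one> \<ominus> t [^] Suc m"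
proof (induction m)
  case 0
  show ?case using assms by simp
next
  case (Suc m)
  have "(\<Oplus>k\<in>{0..Suc m}. t [^] k) = t [^] Suc m \<oplus> (\<Oplus>k\<in>{0..m}. t [^] k)"
    using assms by (simp add: atLeast0_atMost_Suc del: nat_pow_Suc)
  moreover have "t \<otimes> t [^] Suc m = t [^] Suc (Suc m)"
    using assms by (metis nat_pow_Suc2)
  then have "(\<one> \<ominus> t) \<otimes> t [^] Suc m = t [^] Suc m \<ominus> t [^] Suc (Suc m)"
    using assms by (simp add: minus_eq l_distr l_minus del: nat_pow_Suc)
  ultimately have "(\<one> \<ominus> t) \<otimes> (\<Oplus>k\<in>{0..Suc m}. t [^] k)
      = (t [^] Suc m \<ominus> t [^] Suc (Suc m)) \<oplus> (\<one> \<ominus> t [^] Suc m)"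
    using assms Suc by (simp add: r_distr del: nat_pow_Suc)
  also have "\<dots> = (\<one> \<ominus> t [^] Suc (Suc m)) \<oplus> (t [^] Suc m \<ominus> t [^] Suc m)"
    using assms by (simp add: minus_eq a_ac del: nat_pow_Suc)
  also have "\<dots> = \<one> \<ominus> t [^] Suc (Suc m)"
    using assms by (simp add: minus_eq r_neg del: nat_pow_Suc)
  finally show ?case .
qed

text \<open>This is \<open>V W = n I\<close>: each summand is a power of \<open>t i\<close> or of
  its inverse with exponent at most \<open>n - 1\<close>, so off the diagonal one of the two
  families of power sums applies, while on the diagonal the ones are counted.\<close>

lemma (in ring) power_sums_orthogonal:
  fixes n k l :: nat
  assumes "finite I" "t \<in> I \<rightarrow> Units R"
    and "\<And>k. k \<in> {1..n - 1} \<Longrightarrow> (\<Oplus>i\<in>I. t i [^] k) = \<zero>"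
    and "\<And>k. k \<in> {1..n - 1} \<Longrightarrow> (\<Oplus>i\<in>I. inv (t i) [^] k) = \<zero>"
    and "k < n" "l < n"
  shows "(\<Oplus>i\<in>I. t i [^] k \<otimes> inv (t i) [^] l) = (if k = l then nat_elt R (card I) else \<zero>)"
proof -
  have "(\<Oplus>i\<in>I. t i [^] k \<otimes> inv (t i) [^] l)
      = (\<Oplus>i\<in>I. if l \<le> k then t i [^] (k - l) else inv (t i) [^] (l - k))"
    using assms(2) by (intro finsum_cong') (auto simp: Units_pow_mult_inv_pow Units_closed Pi_iff)
  moreover have "(\<Oplus>i\<in>I. \<one>) = nat_elt R (card I)"
    unfolding nat_elt_def by (rule add.finprod_const) auto
  moreover have "k - l \<in> {1..n - 1}" if "l < k" using that assms(5) by auto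
  moreover have "l - k \<in> {1..n - 1}" if "k < l" using that assms(6) by auto
  ultimately show ?thesis
    using assms(3,4) by (cases k l rule: linorder_cases) auto
qed

text \<open>Think of \<open>w\<close> as the linear functional \<open>p \<mapsto> \<Sum>\<^sub>m w\<^sub>m p(s\<^sub>m)\<close> on polynomials and of \<open>f\<close> as the
  monic polynomial of degree \<open>card J\<close> with roots \<open>s\<^sub>j\<close>, \<open>j \<in> J\<close>: the conclusion evaluates \<open>w\<close> at \<open>X\<^sup>l f\<close>.\<close>

lemma (in cring) vanishing_polynomial_moments:
  assumes "finite I" "s \<in> I \<rightarrow> carrier R" "J \<subseteq> I"
  shows "\<exists>f \<in> I \<rightarrow> carrier R. (\<forall>j\<in>J. f j = \<zero>) \<and>
    (\<forall>w \<in> I \<rightarrow> carrier R. \<forall>N. \<forall>y \<in> carrier R.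
      (\<forall>l\<le>N. (\<Oplus>m\<in>I. w m \<otimes> s m [^] (l::nat)) = (if l = N then y else \<zero>)) \<longrightarrow>
      (\<forall>l. l + card J \<le> N \<longrightarrow>
        (\<Oplus>m\<in>I. w m \<otimes> s m [^] l \<otimes> f m) = (if l + card J = N then y else \<zero>)))"
proof -
  have "finite J" using assms finite_subset by blast
  then show ?thesis using assms(3)
  proof (induction J rule: finite_induct)
    case empty
    have "(\<Oplus>m\<in>I. w m \<otimes> s m [^] l \<otimes> \<one>) = (\<Oplus>m\<in>I. w m \<otimes> s m [^] l)"
      if "w \<in> I \<rightarrow> carrier R" for w and l :: nat
      using that assms(2) by (intro finsum_cong') (auto simp: Pi_iff)
    then show ?case by (intro bexI[of _ "\<lambda>_. \<one>"]) auto
  next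
    case (insert a J)
    then obtain f where f: "f \<in> I \<rightarrow> carrier R" and f0: "\<And>j. j \<in> J \<Longrightarrow> f j = \<zero>"
      and moments: "\<And>w N y l. w \<in> I \<rightarrow> carrier R \<Longrightarrow> y \<in> carrier R \<Longrightarrow>
        \<forall>l\<le>N. (\<Oplus>m\<in>I. w m \<otimes> s m [^] l) = (if l = N then y else \<zero>) \<Longrightarrow> l + card J \<le> N \<Longrightarrow>
        (\<Oplus>m\<in>I. w m \<otimes> s m [^] l \<otimes> f m) = (if l + card J = N then y else \<zero>)"
      by auto
    have a: "a \<in> I" "s a \<in> carrier R" using insert.prems assms(2) by auto
    \<comment> \<open>Multiplication by the linear factor \<open>X - s a\<close> adds the root
      \<open>s a\<close> and raises the degree by one.\<close>
    define g where "g m = (s m \<ominus> s a) \<otimes> f m" for m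
    have g: "g \<in> I \<rightarrow> carrier R" using f assms(2) a by (auto simp: g_def Pi_iff)
    have "\<forall>j\<in>insert a J. g j = \<zero>"
      using f f0 a assms(2) insert.prems by (auto simp: g_def Pi_iff r_neg a_minus_def subset_iff)
    moreover have "(\<Oplus>m\<in>I. w m \<otimes> s m [^] l \<otimes> g m) = (if l + card (insert a J) = N then y else \<zero>)"
      if w: "w \<in> I \<rightarrow> carrier R" and y: "y \<in> carrier R" and l: "l + card (insert a J) \<le> N"
        and m: "\<forall>l\<le>N. (\<Oplus>m\<in>I. w m \<otimes> s m [^] l) = (if l = N then y else \<zero>)" for w N y l
    proof -
      \<comment> \<open>Evaluates \<open>X^l (X - s a) f\<close> as
        \<open>X^(l+1) f - s a X^l f\<close>. Both terms fall under the induction hypothesis; since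
        \<open>l + card J < N\<close>, the second contributes zero and only the first can reach the
        top degree \<open>N\<close>.\<close>
      have 1: "w m \<otimes> s m [^] l \<otimes> g m =
          w m \<otimes> s m [^] Suc l \<otimes> f m \<oplus> (\<ominus> s a) \<otimes> (w m \<otimes> s m [^] l \<otimes> f m)" if "m \<in> I" for m
      proof -
        have "w m \<in> carrier R" "s m \<in> carrier R" "f m \<in> carrier R" using that w f assms(2) by auto
        then show ?thesis using a(2) unfolding g_def
          by (simp add: minus_eq l_distr r_distr l_minus r_minus m_ac)
      qed
      have "(\<Oplus>m\<in>I. w m \<otimes> s m [^] l \<otimes> g m) =
          (\<Oplus>m\<in>I. w m \<otimes> s m [^] Suc l \<otimes> f m \<oplus> (\<ominus> s a) \<otimes> (w m \<otimes> s m [^] l \<otimes> f m))"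
        using w f assms(2) a by (intro finsum_cong' 1) (auto simp: Pi_iff simp del: nat_pow_Suc)
      also have "\<dots> = (\<Oplus>m\<in>I. w m \<otimes> s m [^] Suc l \<otimes> f m) \<oplus>
          (\<Oplus>m\<in>I. (\<ominus> s a) \<otimes> (w m \<otimes> s m [^] l \<otimes> f m))"
        using w f assms(2) a by (intro finsum_addf) (auto simp: Pi_iff simp del: nat_pow_Suc)
      also have "(\<Oplus>m\<in>I. (\<ominus> s a) \<otimes> (w m \<otimes> s m [^] l \<otimes> f m)) =
          (\<ominus> s a) \<otimes> (\<Oplus>m\<in>I. (w m \<otimes> s m [^] l \<otimes> f m))"
        using w f assms a
          by (intro finsum_rdistr[symmetric]) (auto simp: Pi_iff simp del: nat_pow_Suc)
      also have "(\<Oplus>m\<in>I. w m \<otimes> s m [^] Suc l \<otimes> f m) = (if Suc l + card J = N then y else \<zero>)"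
        using insert.hyps l by (intro moments[OF w y m]) auto
      also have "(\<Oplus>m\<in>I. w m \<otimes> s m [^] l \<otimes> f m) = (if l + card J = N then y else \<zero>)"
        using insert.hyps l by (intro moments[OF w y m]) auto
      finally show ?thesis using insert.hyps l a y by auto
    qed
    ultimately show ?case using g by blast
  qed
qed

text \<open>The Vandermonde matrices \<open>V = [t\<^sub>m\<^sup>k]\<close> and \<open>W = [t\<^sub>m\<^sup>-\<^sup>k]\<close> satisfy \<open>V W = n I\<close>; the claim is the
  off-diagonal part of \<open>W V = n I\<close>. Determinants are avoided as follows. Let \<open>f\<close> vanish at all
  indices but \<open>i\<close>. A functional \<open>w\<close> with moments \<open>0, \<dots>, 0, y\<close> satisfies \<open>w\<^sub>i f\<^sub>i = y\<close>. The functional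
  \<open>w\<^sub>m = t\<^sub>m\<^sup>n\<^sup>-\<^sup>1\<close> has \<open>y = n\<close>, so \<open>f\<^sub>i\<close> is a unit, and the \<open>j\<close>-th row of \<open>W V - n I\<close> has \<open>y = 0\<close>.\<close>

lemma (in cring) power_sums_orthogonal_dual:
  assumes I: "finite I" "card I = n" and t: "t \<in> I \<rightarrow> Units R" and nu: "nat_elt R n \<in> Units R"
    and pos: "\<And>k. k \<in> {1..n - 1} \<Longrightarrow> (\<Oplus>i\<in>I. t i [^] k) = \<zero>"
    and neg: "\<And>k. k \<in> {1..n - 1} \<Longrightarrow> (\<Oplus>i\<in>I. inv (t i) [^] k) = \<zero>"
    and ij: "i \<in> I" "j \<in> I" "i \<noteq> j"
  shows "(\<Oplus>k\<in>{0..n - 1}. (t i \<otimes> inv (t j)) [^] k) = \<zero>"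
proof -
  let ?K = "{0..n - 1}"
  define s where "s m = inv (t m)" for m
  have tc: "t \<in> I \<rightarrow> carrier R" and s: "s \<in> I \<rightarrow> carrier R" using t
    by (auto simp: s_def Pi_iff Units_closed)
  have "n > 0" using I ij by (auto simp: card_gt_0_iff)
  have nc: "nat_elt R n \<in> carrier R" using nu by auto
  have orth: "(\<Oplus>m\<in>I. t m [^] k \<otimes> s m [^] l) = (if k = l then nat_elt R n else \<zero>)"
    if "k < n" "l < n" for k l
    using power_sums_orthogonal[OF I(1) t pos neg that] I by (simp add: s_def)
  \<comment> \<open>\<open>f\<close> is chosen before the functional, so the same \<open>f\<close>
    may be paired with two different \<open>w\<close> below.\<close>
  obtain f where f: "f \<in> I \<rightarrow> carrier R" and f0: "\<And>m. m \<in> I - {i} \<Longrightarrow> f m = \<zero>"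
    and moments: "\<And>w N y l. w \<in> I \<rightarrow> carrier R \<Longrightarrow> y \<in> carrier R \<Longrightarrow>
        \<forall>l\<le>N. (\<Oplus>m\<in>I. w m \<otimes> s m [^] (l::nat)) = (if l = N then y else \<zero>) \<Longrightarrow> l + card (I - {i}) \<le> N \<Longrightarrow>
        (\<Oplus>m\<in>I. w m \<otimes> s m [^] l \<otimes> f m) = (if l + card (I - {i}) = N then y else \<zero>)"
    using vanishing_polynomial_moments[OF I(1) s, of "I - {i}"] by auto
  have card: "card (I - {i}) = n - 1" using I ij by simp
  \<comment> \<open>The degree of \<open>f\<close> is \<open>n - 1\<close>, so \<open>l = 0\<close>
    already gives the top moment, and in that sum only the term at \<open>i\<close>
    survives.\<close>
  have eval: "w i \<otimes> f i = y"
    if w: "w \<in> I \<rightarrow> carrier R" and y: "y \<in> carrier R"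
      and m: "\<forall>l\<le>n - 1. (\<Oplus>m\<in>I. w m \<otimes> s m [^] l) = (if l = n - 1 then y else \<zero>)" for w y
  proof -
    have "(\<Oplus>m\<in>I. w m \<otimes> s m [^] (0::nat) \<otimes> f m) = (\<Oplus>m\<in>I. if i = m then w m \<otimes> f m else \<zero>)"
      using w f f0 by (intro finsum_cong') (auto simp: Pi_iff)
    also have "\<dots> = w i \<otimes> f i"
      using finsum_singleton[OF ij(1) I(1), of "\<lambda>m. w m \<otimes> f m"] w f by (auto simp: Pi_iff)
    finally show ?thesis using moments[OF w y m, of 0] card by simp
  qed
  \<comment> \<open>\<open>P\<close> is row \<open>j\<close> of \<open>W V\<close>.\<close>
  define P where "P m = (\<Oplus>k\<in>?K. s j [^] k \<otimes> t m [^] k)" for m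
  have sj: "s j \<in> carrier R" using s ij by auto
  have P: "P \<in> I \<rightarrow> carrier R" unfolding P_def using tc sj
    by (intro Pi_I finsum_closed) (auto simp: Pi_iff)
  \<comment> \<open>Row \<open>j\<close> of \<open>(W V) W = W (V W) = n W\<close>: interchange the
    sums and apply \<open>orth\<close>.\<close>
  have reproduce: "(\<Oplus>m\<in>I. P m \<otimes> s m [^] l) = nat_elt R n \<otimes> s j [^] l" if "l < n" for l
  proof -
    have "(\<Oplus>m\<in>I. P m \<otimes> s m [^] l) = (\<Oplus>m\<in>I. \<Oplus>k\<in>?K. s j [^] k \<otimes> (t m [^] k \<otimes> s m [^] l))"
      unfolding P_def using tc s sj
      by (intro finsum_cong') (auto simp: Pi_iff finsum_ldistr m_assoc intro!: finsum_closed)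
    also have "\<dots> = (\<Oplus>k\<in>?K. \<Oplus>m\<in>I. s j [^] k \<otimes> (t m [^] k \<otimes> s m [^] l))"
      using tc s sj I by (intro finsum_swap) (auto simp: Pi_iff)
    also have "\<dots> = (\<Oplus>k\<in>?K. s j [^] k \<otimes> (\<Oplus>m\<in>I. t m [^] k \<otimes> s m [^] l))"
      using tc s sj I
        by (intro finsum_cong') (auto simp: Pi_iff finsum_rdistr intro!: finsum_closed)
    also have "\<dots> = (\<Oplus>k\<in>?K. if l = k then s j [^] k \<otimes> nat_elt R n else \<zero>)"
      using sj nc \<open>n > 0\<close> that by (intro finsum_cong') (auto simp: orth)
    also have "\<dots> = s j [^] l \<otimes> nat_elt R n"
      using finsum_singleton[of l ?K "\<lambda>k. s j [^] k \<otimes> nat_elt R n"] sj nc that by auto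
    finally show ?thesis using sj nc by (simp add: m_comm)
  qed
  have "t i [^] (n - 1) \<otimes> f i = nat_elt R n"
    using tc nc \<open>n > 0\<close> by (intro eval) (auto simp: orth Pi_iff)
  then have unit: "f i \<in> Units R"
    using nu tc f ij by (metis Pi_iff nat_pow_closed unit_factor m_comm)
  define w where "w m = P m \<ominus> (if j = m then nat_elt R n else \<zero>)" for m
  have w: "w \<in> I \<rightarrow> carrier R" using P nc by (auto simp: w_def Pi_iff)
  \<comment> \<open>By \<open>reproduce\<close>, \<open>P\<close> has the same moments below
    \<open>n\<close> as \<open>n\<close> times evaluation at \<open>s j\<close>, which is the term
    subtracted in \<open>w\<close>.\<close>
  have "(\<Oplus>m\<in>I. w m \<otimes> s m [^] l) = \<zero>" if "l < n" for l
  proof -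
    have "(\<Oplus>m\<in>I. w m \<otimes> s m [^] l) =
        (\<Oplus>m\<in>I. P m \<otimes> s m [^] l \<oplus> (if j = m then (\<ominus> nat_elt R n) \<otimes> s m [^] l else \<zero>))"
      using P s nc by (intro finsum_cong') (auto simp: w_def Pi_iff a_minus_def l_distr)
    also have "\<dots> = (\<Oplus>m\<in>I. P m \<otimes> s m [^] l) \<oplus>
        (\<Oplus>m\<in>I. if j = m then (\<ominus> nat_elt R n) \<otimes> s m [^] l else \<zero>)"
      using P s nc by (intro finsum_addf) (auto simp: Pi_iff)
    also have "(\<Oplus>m\<in>I. if j = m then (\<ominus> nat_elt R n) \<otimes> s m [^] l else \<zero>) = (\<ominus> nat_elt R n) \<otimes> s j [^] l"
      using finsum_singleton[OF ij(2) I(1), of "\<lambda>m. (\<ominus> nat_elt R n) \<otimes> s m [^] l"] s nc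
      by (auto simp: Pi_iff)
    also have "(\<Oplus>m\<in>I. P m \<otimes> s m [^] l) = nat_elt R n \<otimes> s j [^] l" using that by (rule reproduce)
    finally show ?thesis using sj nc by (simp add: l_minus r_neg)
  qed
  then have "w i \<otimes> f i = \<zero>" using w \<open>n > 0\<close> by (intro eval) auto
  \<comment> \<open>The correction by \<open>n\<close> sits at \<open>j\<close> only, and
    \<open>i \<noteq> j\<close>; the unit \<open>f i\<close> can then be cancelled from
    \<open>P i \<otimes> f i = \<zero>\<close>.\<close>
  moreover have "w i = P i" using ij P by (auto simp: w_def a_minus_def Pi_iff)
  ultimately have "P i = \<zero>"
    using unit P ij by (metis Pi_iff Units_closed Units_l_cancel l_null m_comm r_null zero_closed)
  moreover have "P i = (\<Oplus>k\<in>?K. (t i \<otimes> inv (t j)) [^] k)"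
    unfolding P_def using tc s sj ij
    by (intro finsum_cong') (auto simp: Pi_iff s_def[symmetric] nat_pow_distrib m_comm)
  ultimately show ?thesis by simp
qed

section \<open>The center\<close>

lemma (in ring) ring_center_closed: "z \<in> ring_center R \<Longrightarrow> z \<in> carrier R"
  by (simp add: ring_center_def)

lemma (in ring) ring_center_comm:
  "\<lbrakk> z \<in> ring_center R; x \<in> carrier R \<rbrakk> \<Longrightarrow> z \<otimes> x = x \<otimes> z"
  by (simp add: ring_center_def)

lemma (in ring) ring_center_lcomm:
  "\<lbrakk> z \<in> ring_center R; x \<in> carrier R; y \<in> carrier R \<rbrakk> \<Longrightarrow> x \<otimes> (z \<otimes> y) = z \<otimes> (x \<otimes> y)"
  by (metis m_assoc ring_center_comm ring_center_closed)

text \<open>Makes results on commutative rings applicable to the entries of \<open>T\<close>, and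
  supplies closure of the center under sums and powers.\<close>

lemma (in ring) ring_center_subcring: "subcring (ring_center R) R"
proof (rule subcringI)
  show "subring (ring_center R) R"
  proof (rule subringI)
    show "z \<otimes> w \<in> ring_center R" if zw: "z \<in> ring_center R" "w \<in> ring_center R" for z w
    proof -
      have carr: "z \<in> carrier R" "w \<in> carrier R" using zw by (simp_all add: ring_center_closed)
      have "z \<otimes> w \<otimes> x = x \<otimes> (z \<otimes> w)" if x: "x \<in> carrier R" for x
      proof -
        have "z \<otimes> w \<otimes> x = z \<otimes> (x \<otimes> w)"
          using carr x ring_center_comm[OF zw(2) x] by (simp add: m_assoc)
        then show ?thesis using ring_center_lcomm[OF zw(1) x carr(2)] by simp
      qed
      then show ?thesis using carr by (simp add: ring_center_def)
    qed
  qed (auto simp: ring_center_def l_minus r_minus l_distr r_distr)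
qed (simp add: ring_center_comm ring_center_closed)

text \<open>Multiply \<open>z x = x z\<close> by \<open>inv z\<close> on both sides.\<close>

lemma (in ring) ring_center_m_inv_closed:
  assumes "z \<in> Units R" "z \<in> ring_center R"
  shows "inv z \<in> ring_center R"
proof -
  have "inv z \<otimes> x = x \<otimes> inv z" if x: "x \<in> carrier R" for x
  proof -
    have "inv z \<otimes> x = inv z \<otimes> (x \<otimes> z) \<otimes> inv z"
      using assms x by (simp add: m_assoc Units_closed)
    also have "\<dots> = inv z \<otimes> (z \<otimes> x) \<otimes> inv z" using assms x by (simp add: ring_center_comm)
    also have "\<dots> = x \<otimes> inv z"
      using assms x by (simp add: m_assoc[symmetric] Units_closed)
    finally show ?thesis .
  qed
  then show ?thesis using assms(1) by (simp add: ring_center_def)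
qed

lemma (in ring) subring_nat_pow_closed:
  "\<lbrakk> subring H R; x \<in> H \<rbrakk> \<Longrightarrow> x [^] (k::nat) \<in> H"
  by (induction k) (auto simp: subringE)

lemma (in ring) subring_finsum_closed:
  assumes "subring H R" "f \<in> A \<rightarrow> H"
  shows "finsum R f A \<in> H"
  using ring.axioms(1)[OF subring_is_ring[OF assms(1)], THEN abelian_group.axioms(1),
      THEN abelian_monoid.finsum_closed, of f A]
    assms by (simp add: finsum_subring)

lemma (in ring) nat_elt_in_center: "nat_elt R k \<in> ring_center R"
  unfolding nat_elt_def ring_center_def by (auto simp: add_pow_ldistr add_pow_rdistr)

text \<open>The polynomial argument takes place in a commutative ring, so it is run in the center.
  What remains is that units, inverses, powers and sums formed there agree with those of
  \<open>R\<close>.\<close>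

lemma (in ring) central_power_sums_orthogonal_dual:
  assumes I: "finite I" "card I = n" and t: "t \<in> I \<rightarrow> Units R \<inter> ring_center R"
    and nu: "nat_elt R n \<in> Units R"
    and pos: "\<And>k. k \<in> {1..n - 1} \<Longrightarrow> (\<Oplus>i\<in>I. t i [^] k) = \<zero>"
    and neg: "\<And>k. k \<in> {1..n - 1} \<Longrightarrow> (\<Oplus>i\<in>I. inv (t i) [^] k) = \<zero>"
    and ij: "i \<in> I" "j \<in> I" "i \<noteq> j"
  shows "(\<Oplus>k\<in>{0..n - 1}. (t i \<otimes> inv (t j)) [^] k) = \<zero>"
proof -
  let ?Z = "R\<lparr>carrier := ring_center R\<rparr>"
  note sub = subcring.axioms(1)[OF ring_center_subcring]
  interpret Z: cring ?Z
    using subcring_iff[of "ring_center R"] ring_center_subcring by (auto simp: ring_center_def)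
  \<comment> \<open>\<open>Units\<close> and \<open>inv\<close> refer to the carrier; they agree
    here because the inverse of a central unit is central.\<close>
  have units: "z \<in> Units ?Z" "inv\<^bsub>?Z\<^esub> z = inv z" if "z \<in> Units R \<inter> ring_center R" for z
  proof -
    have "inv z \<in> ring_center R" using that ring_center_m_inv_closed by auto
    then show "z \<in> Units ?Z" "inv\<^bsub>?Z\<^esub> z = inv z"
      using that Z.comm_inv_char[of z "inv z"]
        by (auto simp: Units_def[of ?Z] intro!: bexI[of _ "inv z"])
  qed
  \<comment> \<open>Multiples and powers are built from the operations alone, which the change of
    carrier leaves intact.\<close>
  have nat_elt: "nat_elt ?Z n = nat_elt R n"
    by (simp add: nat_elt_def add_pow_def nat_pow_def)
  have ti: "t i \<in> ring_center R" "inv (t i) \<in> ring_center R" if "i \<in> I" for i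
    using t that ring_center_m_inv_closed by auto
  have pow: "z [^]\<^bsub>?Z\<^esub> k = z [^] k" for z and k :: nat by (simp add: nat_pow_def)
  have "(\<Oplus>\<^bsub>?Z\<^esub>k\<in>{0..n - 1}. (t i \<otimes>\<^bsub>?Z\<^esub> inv\<^bsub>?Z\<^esub> (t j)) [^]\<^bsub>?Z\<^esub> k) = \<zero>\<^bsub>?Z\<^esub>"
  proof (rule Z.power_sums_orthogonal_dual[OF I _ _ _ _ ij])
    show "t \<in> I \<rightarrow> Units ?Z" using t units by auto
    show "nat_elt ?Z n \<in> Units ?Z" using nu nat_elt_in_center units nat_elt by auto
    fix k assume k: "k \<in> {1..n - 1}"
    have "(\<Oplus>\<^bsub>?Z\<^esub>i\<in>I. t i [^]\<^bsub>?Z\<^esub> k) = (\<Oplus>i\<in>I. t i [^] k)"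
      unfolding pow using ti by (intro finsum_subring sub Pi_I subring_nat_pow_closed)
    then show "(\<Oplus>\<^bsub>?Z\<^esub>i\<in>I. t i [^]\<^bsub>?Z\<^esub> k) = \<zero>\<^bsub>?Z\<^esub>" using pos[OF k] by simp
    have "(\<Oplus>\<^bsub>?Z\<^esub>i\<in>I. inv\<^bsub>?Z\<^esub> (t i) [^]\<^bsub>?Z\<^esub> k) = (\<Oplus>\<^bsub>?Z\<^esub>i\<in>I. inv (t i) [^] k)"
      unfolding pow using t units(2) ti
        by (intro Z.finsum_cong') (auto simp: Pi_iff intro!: subring_nat_pow_closed sub)
    also have "\<dots> = (\<Oplus>i\<in>I. inv (t i) [^] k)"
      using ti by (intro finsum_subring sub Pi_I subring_nat_pow_closed)
    finally show "(\<Oplus>\<^bsub>?Z\<^esub>i\<in>I. inv\<^bsub>?Z\<^esub> (t i) [^]\<^bsub>?Z\<^esub> k) = \<zero>\<^bsub>?Z\<^esub>" using neg[OF k] by simp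
  qed
  moreover have "inv\<^bsub>?Z\<^esub> (t j) = inv (t j)" using t ij units by auto
  moreover have "(\<Oplus>\<^bsub>?Z\<^esub>k\<in>{0..n - 1}. (t i \<otimes> inv (t j)) [^] k) = (\<Oplus>k\<in>{0..n - 1}. (t i \<otimes> inv (t j)) [^] k)"
    using ti ij by (intro finsum_subring sub Pi_I subring_nat_pow_closed subringE(6)[OF sub]) auto
  ultimately show ?thesis unfolding pow by simp
qed

section \<open>Matrix rings\<close>

lemma mk_mat_apply [simp]: "\<lbrakk> i \<in> {1..n}; j \<in> {1..n} \<rbrakk> \<Longrightarrow> mk_mat n f i j = f i j"
  by (simp add: mk_mat_def)

lemma mk_mat_in_carrier:
  "(\<And>i j. \<lbrakk> i \<in> {1..n}; j \<in> {1..n} \<rbrakk> \<Longrightarrow> f i j \<in> carrier R) \<Longrightarrow> mk_mat n f \<in> carrier (mat_ring n R)"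
  by (auto simp: mk_mat_def mat_ring_def)

lemma mk_mat_cong:
  "(\<And>i j. \<lbrakk> i \<in> {1..n}; j \<in> {1..n} \<rbrakk> \<Longrightarrow> f i j = g i j) \<Longrightarrow> mk_mat n f = mk_mat n g"
  by (auto simp: mk_mat_def intro!: restrict_ext)

lemma mat_ring_entry_closed:
  "\<lbrakk> A \<in> carrier (mat_ring n R); i \<in> {1..n}; j \<in> {1..n} \<rbrakk> \<Longrightarrow> A i j \<in> carrier R"
  by (auto simp: mat_ring_def PiE_iff)

lemma mk_mat_entries: "A \<in> carrier (mat_ring n R) \<Longrightarrow> mk_mat n A = A"
  unfolding mat_ring_def mk_mat_def by (auto simp: fun_eq_iff PiE_iff restrict_def extensional_def)

lemma mat_ring_simps:
  "A \<otimes>\<^bsub>mat_ring n R\<^esub> B = mk_mat n (\<lambda>i j. \<Oplus>\<^bsub>R\<^esub>k\<in>{1..n}. A i k \<otimes>\<^bsub>R\<^esub> B k j)"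
  "\<one>\<^bsub>mat_ring n R\<^esub> = mk_mat n (\<lambda>i j. if i = j then \<one>\<^bsub>R\<^esub> else \<zero>\<^bsub>R\<^esub>)"
  "\<zero>\<^bsub>mat_ring n R\<^esub> = mk_mat n (\<lambda>i j. \<zero>\<^bsub>R\<^esub>)"
  "A \<oplus>\<^bsub>mat_ring n R\<^esub> B = mk_mat n (\<lambda>i j. A i j \<oplus>\<^bsub>R\<^esub> B i j)"
  by (simp_all add: mat_ring_def)

lemma mat_eqI:
  assumes "A \<in> carrier (mat_ring n R)" "B \<in> carrier (mat_ring n R)"
    and "\<And>i j. \<lbrakk> i \<in> {1..n}; j \<in> {1..n} \<rbrakk> \<Longrightarrow> A i j = B i j"
  shows "A = B"
proof -
  have "mk_mat n A = mk_mat n B" using assms(3) by (rule mk_mat_cong)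
  then show ?thesis by (simp only: mk_mat_entries[OF assms(1)] mk_mat_entries[OF assms(2)])
qed

text \<open>Coefficients need not commute, so the order of the factors is kept in every sum;
  associativity is the interchange of the two summations.\<close>

lemma (in ring) mat_ring_is_ring: "ring (mat_ring n R)"
proof (rule ringI)
  let ?M = "mat_ring n R"
  note [simp] = mat_ring_entry_closed[of _ n R]
  show "abelian_group ?M"
  proof (rule abelian_groupI)
    show "\<exists>B\<in>carrier ?M. B \<oplus>\<^bsub>?M\<^esub> A = \<zero>\<^bsub>?M\<^esub>" if A: "A \<in> carrier ?M" for A
      using A by (intro bexI[of _ "mk_mat n (\<lambda>i j. \<ominus> A i j)"])
        (auto simp: mat_ring_simps l_neg
          intro!: mk_mat_cong mk_mat_in_carrier simp del: atLeastAtMost_iff)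
    show "\<zero>\<^bsub>?M\<^esub> \<oplus>\<^bsub>?M\<^esub> A = A" if A: "A \<in> carrier ?M" for A
      using A
        by (intro mat_eqI[of _ n R])
          (auto simp: mat_ring_simps intro!: mk_mat_in_carrier simp del: atLeastAtMost_iff)
  qed
    (auto simp: mat_ring_simps a_ac intro!: mk_mat_in_carrier mk_mat_cong simp del: atLeastAtMost_iff)
  have mult_closed: "A \<otimes>\<^bsub>?M\<^esub> B \<in> carrier ?M" if "A \<in> carrier ?M" "B \<in> carrier ?M" for A B
    using that unfolding mat_ring_simps
    by (intro mk_mat_in_carrier finsum_closed) (auto simp del: atLeastAtMost_iff)
  show "Group.monoid ?M"
  proof (rule monoidI)
    show "A \<otimes>\<^bsub>?M\<^esub> B \<in> carrier ?M" if "A \<in> carrier ?M" "B \<in> carrier ?M" for A B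
      using that by (rule mult_closed)
    show "\<one>\<^bsub>?M\<^esub> \<in> carrier ?M" by (auto simp: mat_ring_simps intro!: mk_mat_in_carrier)
    show "A \<otimes>\<^bsub>?M\<^esub> B \<otimes>\<^bsub>?M\<^esub> C = A \<otimes>\<^bsub>?M\<^esub> (B \<otimes>\<^bsub>?M\<^esub> C)"
      if A: "A \<in> carrier ?M" and B: "B \<in> carrier ?M" and C: "C \<in> carrier ?M" for A B C
      unfolding mat_ring_simps
    proof (rule mk_mat_cong)
      fix i j assume i: "i \<in> {1..n}" and j: "j \<in> {1..n}"
      have "(\<Oplus>k\<in>{1..n}. mk_mat n (\<lambda>i j. \<Oplus>k\<in>{1..n}. A i k \<otimes> B k j) i k \<otimes> C k j)
          = (\<Oplus>k\<in>{1..n}. \<Oplus>l\<in>{1..n}. A i l \<otimes> B l k \<otimes> C k j)"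
        using A B C i j
          by (intro finsum_cong')
            (auto simp: finsum_ldistr Pi_iff simp del: atLeastAtMost_iff intro!: finsum_closed)
      also have "\<dots> = (\<Oplus>l\<in>{1..n}. \<Oplus>k\<in>{1..n}. A i l \<otimes> B l k \<otimes> C k j)"
        using A B C i j by (intro finsum_swap) (auto simp del: atLeastAtMost_iff)
      also have "\<dots> = (\<Oplus>l\<in>{1..n}. \<Oplus>k\<in>{1..n}. A i l \<otimes> (B l k \<otimes> C k j))"
        using A B C i j
        by (intro finsum_cong')
          (auto simp: m_assoc simp del: atLeastAtMost_iff intro!: finsum_closed)
      also have "\<dots> = (\<Oplus>l\<in>{1..n}. A i l \<otimes> mk_mat n (\<lambda>i j. \<Oplus>k\<in>{1..n}. B i k \<otimes> C k j) l j)"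
        using A B C i j
        by (intro finsum_cong')
          (auto simp: finsum_rdistr Pi_iff simp del: atLeastAtMost_iff intro!: finsum_closed)
      finally show "(\<Oplus>k\<in>{1..n}. mk_mat n (\<lambda>i j. \<Oplus>k\<in>{1..n}. A i k \<otimes> B k j) i k \<otimes> C k j) =
          (\<Oplus>l\<in>{1..n}. A i l \<otimes> mk_mat n (\<lambda>i j. \<Oplus>k\<in>{1..n}. B i k \<otimes> C k j) l j)" .
    qed
    show "\<one>\<^bsub>?M\<^esub> \<otimes>\<^bsub>?M\<^esub> A = A" if A: "A \<in> carrier ?M" for A
    proof -
      have "\<one>\<^bsub>?M\<^esub> \<otimes>\<^bsub>?M\<^esub> A = mk_mat n A"
        unfolding mat_ring_simps
      proof (rule mk_mat_cong)
        fix i j assume i: "i \<in> {1..n}" and j: "j \<in> {1..n}"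
        have "(\<Oplus>k\<in>{1..n}. mk_mat n (\<lambda>i j. if i = j then \<one> else \<zero>) i k \<otimes> A k j)
            = (\<Oplus>k\<in>{1..n}. if i = k then A k j else \<zero>)"
          using A i j by (intro finsum_cong') (auto simp del: atLeastAtMost_iff)
        also have "\<dots> = A i j"
          using A i j by (intro finsum_singleton) (auto simp del: atLeastAtMost_iff)
        finally show "(\<Oplus>k\<in>{1..n}. mk_mat n (\<lambda>i j. if i = j then \<one> else \<zero>) i k \<otimes> A k j) = A i j" .
      qed
      then show ?thesis using mk_mat_entries[OF A] by simp
    qed
    show "A \<otimes>\<^bsub>?M\<^esub> \<one>\<^bsub>?M\<^esub> = A" if A: "A \<in> carrier ?M" for A
    proof -
      have "A \<otimes>\<^bsub>?M\<^esub> \<one>\<^bsub>?M\<^esub> = mk_mat n A"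
        unfolding mat_ring_simps
      proof (rule mk_mat_cong)
        fix i j assume i: "i \<in> {1..n}" and j: "j \<in> {1..n}"
        have "(\<Oplus>k\<in>{1..n}. A i k \<otimes> mk_mat n (\<lambda>i j. if i = j then \<one> else \<zero>) k j)
            = (\<Oplus>k\<in>{1..n}. if j = k then A i k else \<zero>)"
          using A i j by (intro finsum_cong') (auto simp del: atLeastAtMost_iff)
        also have "\<dots> = A i j"
          using A i j by (intro finsum_singleton) (auto simp del: atLeastAtMost_iff)
        finally show "(\<Oplus>k\<in>{1..n}. A i k \<otimes> mk_mat n (\<lambda>i j. if i = j then \<one> else \<zero>) k j) = A i j" .
      qed
      then show ?thesis using mk_mat_entries[OF A] by simp
    qed
  qed
  show "(A \<oplus>\<^bsub>?M\<^esub> B) \<otimes>\<^bsub>?M\<^esub> C = A \<otimes>\<^bsub>?M\<^esub> C \<oplus>\<^bsub>?M\<^esub> B \<otimes>\<^bsub>?M\<^esub> C"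
    if A: "A \<in> carrier ?M" and B: "B \<in> carrier ?M" and C: "C \<in> carrier ?M" for A B C
    unfolding mat_ring_simps
  proof (rule mk_mat_cong)
    fix i j assume i: "i \<in> {1..n}" and j: "j \<in> {1..n}"
    have "(\<Oplus>k\<in>{1..n}. mk_mat n (\<lambda>i j. A i j \<oplus> B i j) i k \<otimes> C k j)
        = (\<Oplus>k\<in>{1..n}. A i k \<otimes> C k j \<oplus> B i k \<otimes> C k j)"
      using A B C i j by (intro finsum_cong') (auto simp: l_distr simp del: atLeastAtMost_iff)
    also have "\<dots> = (\<Oplus>k\<in>{1..n}. A i k \<otimes> C k j) \<oplus> (\<Oplus>k\<in>{1..n}. B i k \<otimes> C k j)"
      using A B C i j by (intro finsum_addf) (auto simp del: atLeastAtMost_iff)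
    finally show "(\<Oplus>k\<in>{1..n}. mk_mat n (\<lambda>i j. A i j \<oplus> B i j) i k \<otimes> C k j) =
        mk_mat n (\<lambda>i j. \<Oplus>k\<in>{1..n}. A i k \<otimes> C k j) i j \<oplus> mk_mat n (\<lambda>i j. \<Oplus>k\<in>{1..n}. B i k \<otimes> C k j) i j"
      using i j by simp
  qed
  show "C \<otimes>\<^bsub>?M\<^esub> (A \<oplus>\<^bsub>?M\<^esub> B) = C \<otimes>\<^bsub>?M\<^esub> A \<oplus>\<^bsub>?M\<^esub> C \<otimes>\<^bsub>?M\<^esub> B"
    if A: "A \<in> carrier ?M" and B: "B \<in> carrier ?M" and C: "C \<in> carrier ?M" for A B C
    unfolding mat_ring_simps
  proof (rule mk_mat_cong)
    fix i j assume i: "i \<in> {1..n}" and j: "j \<in> {1..n}"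
    have "(\<Oplus>k\<in>{1..n}. C i k \<otimes> mk_mat n (\<lambda>i j. A i j \<oplus> B i j) k j)
        = (\<Oplus>k\<in>{1..n}. C i k \<otimes> A k j \<oplus> C i k \<otimes> B k j)"
      using A B C i j by (intro finsum_cong') (auto simp: r_distr simp del: atLeastAtMost_iff)
    also have "\<dots> = (\<Oplus>k\<in>{1..n}. C i k \<otimes> A k j) \<oplus> (\<Oplus>k\<in>{1..n}. C i k \<otimes> B k j)"
      using A B C i j by (intro finsum_addf) (auto simp del: atLeastAtMost_iff)
    finally show "(\<Oplus>k\<in>{1..n}. C i k \<otimes> mk_mat n (\<lambda>i j. A i j \<oplus> B i j) k j) =
        mk_mat n (\<lambda>i j. \<Oplus>k\<in>{1..n}. C i k \<otimes> A k j) i j \<oplus> mk_mat n (\<lambda>i j. \<Oplus>k\<in>{1..n}. C i k \<otimes> B k j) i j"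
      using i j by simp
  qed
qed

section \<open>Endomorphisms and transitive matrices\<close>

text \<open>Standing hypotheses. Centrality is assumed for the first column and reaches every entry
  in \<open>T_center\<close>.\<close>

locale transitive_matrix_endomorphism = ring R for R (structure) +
  fixes n :: nat and \<delta> :: "'a \<Rightarrow> 'a" and T :: "nat \<Rightarrow> nat \<Rightarrow> 'a"
  assumes n_pos: "1 \<le> n"
    and n_unit: "nat_elt R n \<in> Units R"
    and endo: "\<delta> \<in> ring_hom R R"
    and transitive: "transitive_mat n R T"
    and first_column: "\<And>i. i \<in> {1..n} \<Longrightarrow> T i 1 \<in> Units R \<inter> ring_center R"
begin

sublocale endo: ring_hom_ring R R \<delta>
  by (rule ring_hom_ringI2[OF ring_axioms ring_axioms endo])

lemma one_index: "1 \<in> {1..n}"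
  using n_pos by simp

lemma T_diag: "i \<in> {1..n} \<Longrightarrow> T i i = \<one>"
  and T_mult: "\<lbrakk> i \<in> {1..n}; j \<in> {1..n}; k \<in> {1..n} \<rbrakk> \<Longrightarrow> T i j \<otimes> T j k = T i k"
  and T_closed: "\<lbrakk> i \<in> {1..n}; j \<in> {1..n} \<rbrakk> \<Longrightarrow> T i j \<in> carrier R"
  using transitive mat_ring_entry_closed[of T n R] unfolding transitive_mat_def by blast+

text \<open>Transitivity gives \<open>T i j \<otimes> T j i = T i i = \<one>\<close>. Inverses thus
  become transposed entries, and negative powers become powers of these.\<close>

lemma inv_T: "\<lbrakk> i \<in> {1..n}; j \<in> {1..n} \<rbrakk> \<Longrightarrow> inv (T i j) = T j i"
  using T_mult[of i j i] T_mult[of j i j] T_diag T_closed by (intro inv_char) auto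

text \<open>Factor \<open>T i j = T i 1 \<otimes> T 1 j\<close>, where \<open>T 1 j\<close> is the
  inverse of the central unit \<open>T j 1\<close>.\<close>

lemma T_center:
  assumes "i \<in> {1..n}" "j \<in> {1..n}"
  shows "T i j \<in> ring_center R"
proof -
  have "T 1 j \<in> ring_center R"
    using first_column[OF assms(2)] ring_center_m_inv_closed[of "T j 1"] inv_T[OF assms(2) one_index] by auto
  then show ?thesis
    using subcringE(6)[OF ring_center_subcring, of "T i 1" "T 1 j"] first_column[OF assms(1)]
      T_mult[OF assms(1) one_index assms(2)] by auto
qed

lemma T_pow_center: "\<lbrakk> i \<in> {1..n}; j \<in> {1..n} \<rbrakk> \<Longrightarrow> T i j [^] (k::nat) \<in> ring_center R"
  using subring_nat_pow_closed[OF subcring.axioms(1)[OF ring_center_subcring]] T_center by blast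

lemma T_pow_closed: "\<lbrakk> i \<in> {1..n}; j \<in> {1..n} \<rbrakk> \<Longrightarrow> T i j [^] (k::nat) \<in> carrier R"
  using T_closed by simp

text \<open>Since the entries commute, entrywise powers of \<open>T\<close> inherit
  transitivity.\<close>

lemma T_pow_mult:
  assumes "i \<in> {1..n}" "j \<in> {1..n}" "l \<in> {1..n}"
  shows "T i j [^] (k::nat) \<otimes> T j l [^] k = T i l [^] k"
  using pow_mult_distrib[of "T i j" "T j l" k] assms T_mult T_closed
    ring_center_comm[OF T_center] by metis

section \<open>The scalar 1/n and the iterates of the endomorphism\<close>

abbreviation "inv_n \<equiv> inv (nat_elt R n)"

lemma inv_n_center: "inv_n \<in> ring_center R"
  using n_unit nat_elt_in_center by (rule ring_center_m_inv_closed)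

lemma inv_n_closed [simp]: "inv_n \<in> carrier R"
  using n_unit by simp

lemma nat_elt_closed [simp]: "nat_elt R n \<in> carrier R"
  using n_unit by (rule Units_closed)

lemma endo_pow_hom: "(\<delta> ^^ k) \<in> ring_hom R R"
proof (induction k)
  case 0
  show ?case using id_ring_hom by (simp add: id_def)
next
  case (Suc k)
  show ?case using ring_hom_trans[OF Suc endo] by (simp add: comp_def)
qed

lemma endo_pow_closed [simp]: "r \<in> carrier R \<Longrightarrow> (\<delta> ^^ k) r \<in> carrier R"
  by (rule ring_hom_closed[OF endo_pow_hom])

lemma endo_pow_Fix: "r \<in> Fix R \<delta> \<Longrightarrow> (\<delta> ^^ k) r = r"
  by (induction k) (auto simp: Fix_def)

section \<open>Entries of the map and linearity over the fixed ring\<close>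

lemma delta_sum_closed:
  "\<lbrakk> r \<in> carrier R; i \<in> {1..n}; j \<in> {1..n} \<rbrakk> \<Longrightarrow> delta_sum n R \<delta> T r i j \<in> carrier R"
  unfolding delta_sum_def using T_closed by (intro finsum_closed) auto

lemma delta_bar_apply:
  "\<lbrakk> i \<in> {1..n}; j \<in> {1..n} \<rbrakk> \<Longrightarrow> delta_bar n R \<delta> T r i j = inv_n \<otimes> delta_sum n R \<delta> T r i j"
  unfolding delta_bar_def by (rule mk_mat_apply)

lemma delta_bar_closed: "r \<in> carrier R \<Longrightarrow> delta_bar n R \<delta> T r \<in> carrier (mat_ring n R)"
  unfolding delta_bar_def using delta_sum_closed by (intro mk_mat_in_carrier) simp

lemma delta_sum_inv:
  assumes "r \<in> carrier R" "i \<in> {1..n}" "j \<in> {1..n}"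
  shows "delta_sum n R \<delta> T r i j = (\<Oplus>k\<in>{0..n - 1}. inv (T i j) [^] k \<otimes> (\<delta> ^^ k) r)"
  unfolding delta_sum_def using assms by (simp add: inv_T del: atLeastAtMost_iff)

text \<open>The iterates of \<open>\<delta>\<close> fix \<open>c\<close>, which then moves left past
  the central powers of \<open>T j i\<close>; the right-handed version is plain
  associativity.\<close>

lemma delta_sum_lmult_Fix:
  assumes "r \<in> carrier R" "c \<in> Fix R \<delta>" "i \<in> {1..n}" "j \<in> {1..n}"
  shows "delta_sum n R \<delta> T (c \<otimes> r) i j = c \<otimes> delta_sum n R \<delta> T r i j"
proof -
  have c: "c \<in> carrier R" using assms(2) by (simp add: Fix_def)
  have "delta_sum n R \<delta> T (c \<otimes> r) i j = (\<Oplus>k\<in>{0..n - 1}. c \<otimes> (T j i [^] k \<otimes> (\<delta> ^^ k) r))"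
    unfolding delta_sum_def using assms c T_pow_closed[OF assms(4,3)]
    by (intro finsum_cong') (auto simp: ring_hom_mult[OF endo_pow_hom] endo_pow_Fix
        ring_center_lcomm[OF T_pow_center[OF assms(4,3)]])
  then show ?thesis
    unfolding delta_sum_def using assms c T_pow_closed[OF assms(4,3)]
    by (simp add: finsum_rdistr Pi_def)
qed

lemma delta_sum_rmult_Fix:
  assumes "r \<in> carrier R" "c \<in> Fix R \<delta>" "i \<in> {1..n}" "j \<in> {1..n}"
  shows "delta_sum n R \<delta> T (r \<otimes> c) i j = delta_sum n R \<delta> T r i j \<otimes> c"
proof -
  have c: "c \<in> carrier R" using assms(2) by (simp add: Fix_def)
  have "delta_sum n R \<delta> T (r \<otimes> c) i j = (\<Oplus>k\<in>{0..n - 1}. T j i [^] k \<otimes> (\<delta> ^^ k) r \<otimes> c)"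
    unfolding delta_sum_def using assms c T_pow_closed[OF assms(4,3)]
    by (intro finsum_cong') (auto simp: ring_hom_mult[OF endo_pow_hom] endo_pow_Fix m_assoc)
  then show ?thesis
    unfolding delta_sum_def using assms c T_pow_closed[OF assms(4,3)]
    by (simp add: finsum_ldistr Pi_def)
qed

lemma delta_bar_lmult_Fix:
  assumes "r \<in> carrier R" "c \<in> Fix R \<delta>"
  shows "delta_bar n R \<delta> T (c \<otimes> r) = mat_lmult n R c (delta_bar n R \<delta> T r)"
  unfolding delta_bar_def mat_lmult_def
proof (rule mk_mat_cong)
  fix i j assume "i \<in> {1..n}" "j \<in> {1..n}"
  then show "inv_n \<otimes> delta_sum n R \<delta> T (c \<otimes> r) i j =
      c \<otimes> mk_mat n (\<lambda>i j. inv_n \<otimes> delta_sum n R \<delta> T r i j) i j"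
    using assms delta_sum_closed
    by (simp add: delta_sum_lmult_Fix ring_center_lcomm[OF inv_n_center] Fix_def
        del: atLeastAtMost_iff)
qed

lemma delta_bar_rmult_Fix:
  assumes "r \<in> carrier R" "c \<in> Fix R \<delta>"
  shows "delta_bar n R \<delta> T (r \<otimes> c) = mat_rmult n R (delta_bar n R \<delta> T r) c"
  unfolding delta_bar_def mat_rmult_def
proof (rule mk_mat_cong)
  fix i j assume "i \<in> {1..n}" "j \<in> {1..n}"
  then show "inv_n \<otimes> delta_sum n R \<delta> T (r \<otimes> c) i j =
      mk_mat n (\<lambda>i j. inv_n \<otimes> delta_sum n R \<delta> T r i j) i j \<otimes> c"
    using assms delta_sum_closed
    by (simp add: delta_sum_rmult_Fix m_assoc Fix_def del: atLeastAtMost_iff)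
qed

section \<open>Images of fixed elements: statement (1)\<close>

lemma delta_sum_Fix:
  assumes "r \<in> Fix R \<delta>" "i \<in> {1..n}" "j \<in> {1..n}"
  shows "delta_sum n R \<delta> T r i j = (\<Oplus>k\<in>{0..n - 1}. T j i [^] k) \<otimes> r"
  unfolding delta_sum_def using assms T_closed[OF assms(3,2)]
  by (subst finsum_ldistr) (auto simp: endo_pow_Fix Fix_def)

text \<open>The sum has \<open>n\<close> terms equal to one: \<open>{0..n - 1}\<close> has
  \<open>n\<close> elements because \<open>1 \<le> n\<close>, whereas truncated subtraction would
  leave one element for \<open>n = 0\<close>.\<close>

lemma T_diag_pow_sum: "i \<in> {1..n} \<Longrightarrow> (\<Oplus>k\<in>{0..n - 1}. T i i [^] (k::nat)) = nat_elt R n"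
  using n_pos by (simp add: T_diag nat_elt_def add.finprod_const del: atLeastAtMost_iff)

text \<open>Common core of (1) and of preservation of the unit in (2). The vanishing off-diagonal
  sums come from cancelling \<open>1 - t\<close> in the first case and from \<open>W V = n I\<close>
  in the second.\<close>

lemma delta_bar_Fix_scalar:
  assumes "r \<in> Fix R \<delta>"
    and "\<And>i j. \<lbrakk> i \<in> {1..n}; j \<in> {1..n}; i \<noteq> j \<rbrakk> \<Longrightarrow> (\<Oplus>k\<in>{0..n - 1}. T j i [^] k) = \<zero>"
  shows "delta_bar n R \<delta> T r = mat_lmult n R r \<one>\<^bsub>mat_ring n R\<^esub>"
  unfolding delta_bar_def mat_lmult_def mat_ring_simps
proof (rule mk_mat_cong)
  fix i j assume i: "i \<in> {1..n}" and j: "j \<in> {1..n}"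
  have r: "r \<in> carrier R" using assms(1) by (simp add: Fix_def)
  show "inv_n \<otimes> delta_sum n R \<delta> T r i j = r \<otimes> mk_mat n (\<lambda>i j. if i = j then \<one> else \<zero>) i j"
  proof (cases "i = j")
    case True
    have "delta_sum n R \<delta> T r i i = nat_elt R n \<otimes> r"
      unfolding delta_sum_Fix[OF assms(1) i i] T_diag_pow_sum[OF i] ..
    then show ?thesis
      using True i r n_unit by (simp add: m_assoc[symmetric] del: atLeastAtMost_iff)
  next
    case False
    then have "delta_sum n R \<delta> T r i j = \<zero>"
      unfolding delta_sum_Fix[OF assms(1) i j] assms(2)[OF i j False] using r by simp
    then show ?thesis
      using False i j r by (simp del: atLeastAtMost_iff)
  qed
qed

text \<open>The powers \<open>T 1 j [^] n\<close> and \<open>T j 1 [^] n = \<one>\<close> are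
  mutually inverse, so the first row satisfies the relation too; then factor through index
  1.\<close>

lemma T_pow_n:
  assumes "\<And>i. i \<in> {1..n} \<Longrightarrow> T i 1 [^] n = \<one>" "i \<in> {1..n}" "j \<in> {1..n}"
  shows "T i j [^] n = \<one>"
proof -
  have "T 1 j [^] n = \<one>"
    using T_pow_mult[OF one_index assms(3) one_index, of n] assms(1)[OF assms(3)] T_diag[OF one_index]
      T_closed[OF one_index assms(3)] by simp
  then show ?thesis
    using T_pow_mult[OF assms(2) one_index assms(3), of n] assms(1)[OF assms(2)] by simp
qed

text \<open>The geometric sum is annihilated by \<open>1 - t\<close>. Cancellation is available only
  within the center, so the sum is first shown to be central.\<close>

lemma T_pow_sum_eq_zero:
  assumes "\<And>i. i \<in> {1..n} \<Longrightarrow> T i 1 [^] n = \<one>" "i \<in> {1..n}" "j \<in> {1..n}"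
    and "non_zero_divisor (R\<lparr>carrier := ring_center R\<rparr>) (\<one> \<ominus> T i j)"
  shows "(\<Oplus>k\<in>{0..n - 1}. T i j [^] k) = \<zero>"
proof -
  have "(\<Oplus>k\<in>{0..n - 1}. T i j [^] k) \<in> ring_center R"
    using T_pow_center[OF assms(2,3)] subcring.axioms(1)[OF ring_center_subcring]
    by (intro subring_finsum_closed) auto
  moreover have "(\<one> \<ominus> T i j) \<otimes> (\<Oplus>k\<in>{0..n - 1}. T i j [^] k) = \<zero>"
    using one_minus_mult_pow_sum[OF T_closed[OF assms(2,3)], of "n - 1"] n_pos T_pow_n[OF assms(1-3)]
    by (simp add: minus_eq r_neg del: nat_pow_Suc)
  ultimately show ?thesis using assms(4) by (simp add: non_zero_divisor_def)
qed

section \<open>Embedding into the full matrix ring: statement (2)\<close>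

lemma delta_bar_add:
  assumes "r \<in> carrier R" "s \<in> carrier R"
  shows "delta_bar n R \<delta> T (r \<oplus> s) = delta_bar n R \<delta> T r \<oplus>\<^bsub>mat_ring n R\<^esub> delta_bar n R \<delta> T s"
  unfolding delta_bar_def mat_ring_simps
proof (rule mk_mat_cong)
  fix i j assume i: "i \<in> {1..n}" and j: "j \<in> {1..n}"
  have "delta_sum n R \<delta> T (r \<oplus> s) i j =
      (\<Oplus>k\<in>{0..n - 1}. T j i [^] k \<otimes> (\<delta> ^^ k) r \<oplus> T j i [^] k \<otimes> (\<delta> ^^ k) s)"
    unfolding delta_sum_def using assms T_closed[OF j i]
    by (intro finsum_cong') (auto simp: ring_hom_add[OF endo_pow_hom] r_distr)
  also have "\<dots> = delta_sum n R \<delta> T r i j \<oplus> delta_sum n R \<delta> T s i j"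
    unfolding delta_sum_def using assms T_closed[OF j i] by (intro finsum_addf) auto
  finally show "inv_n \<otimes> delta_sum n R \<delta> T (r \<oplus> s) i j =
      mk_mat n (\<lambda>i j. inv_n \<otimes> delta_sum n R \<delta> T r i j) i j \<oplus>
      mk_mat n (\<lambda>i j. inv_n \<otimes> delta_sum n R \<delta> T s i j) i j"
    using assms i j delta_sum_closed by (simp add: r_distr del: atLeastAtMost_iff)
qed

context
  assumes vanish: "power_sums_vanish n R T"
begin

lemma pos_power_sum: "k \<in> {1..n - 1} \<Longrightarrow> (\<Oplus>i\<in>{1..n}. T i 1 [^] k) = \<zero>"
  and neg_power_sum: "k \<in> {1..n - 1} \<Longrightarrow> (\<Oplus>i\<in>{1..n}. inv (T i 1) [^] k) = \<zero>"
  using vanish unfolding power_sums_vanish_def by blast+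

lemma T_orthogonal:
  assumes "k < n" "l < n"
  shows "(\<Oplus>m\<in>{1..n}. T m 1 [^] k \<otimes> T 1 m [^] l) = (if k = l then nat_elt R n else \<zero>)"
proof -
  have "(\<Oplus>m\<in>{1..n}. T m 1 [^] k \<otimes> T 1 m [^] l) = (\<Oplus>m\<in>{1..n}. T m 1 [^] k \<otimes> inv (T m 1) [^] l)"
    using T_closed one_index
      by (intro finsum_cong') (auto simp: inv_T Pi_iff simp del: atLeastAtMost_iff)
  then show ?thesis
    using power_sums_orthogonal[of "{1..n}" "\<lambda>m. T m 1" n k l] pos_power_sum neg_power_sum assms first_column
    by (simp add: Pi_iff del: atLeastAtMost_iff)
qed

text \<open>\<open>\<one>\<close> is fixed by \<open>\<delta>\<close>, so its image is scalar once
  the off-diagonal sums vanish; these are the entries of \<open>W V\<close>, as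
  \<open>T j i = T j 1 \<otimes> inv (T i 1)\<close>.\<close>

lemma delta_bar_one: "delta_bar n R \<delta> T \<one> = \<one>\<^bsub>mat_ring n R\<^esub>"
proof -
  have "(\<Oplus>k\<in>{0..n - 1}. T j i [^] k) = \<zero>" if "i \<in> {1..n}" "j \<in> {1..n}" "i \<noteq> j" for i j
  proof -
    have "T j 1 \<otimes> inv (T i 1) = T j i" using that one_index
      by (simp add: inv_T T_mult del: atLeastAtMost_iff)
    then show ?thesis
      using central_power_sums_orthogonal_dual[of "{1..n}" n "\<lambda>m. T m 1" j i] pos_power_sum neg_power_sum
        first_column n_unit that by (simp add: Pi_iff del: atLeastAtMost_iff)
  qed
  then have "delta_bar n R \<delta> T \<one> = mat_lmult n R \<one> \<one>\<^bsub>mat_ring n R\<^esub>"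
    by (intro delta_bar_Fix_scalar) (auto simp: Fix_def)
  also have "\<dots> = \<one>\<^bsub>mat_ring n R\<^esub>"
    unfolding mat_lmult_def mat_ring_simps by (rule mk_mat_cong) simp
  finally show ?thesis .
qed

text \<open>Routing entries through index 1, as in \<open>T m i = T m 1 \<otimes> T 1 i\<close>,
  isolates the dependence on \<open>m\<close>. The sum over \<open>m\<close> is then an entry of
  \<open>V W\<close> and leaves only the terms with \<open>k = l\<close>.\<close>

lemma delta_sum_mult:
  assumes r: "r \<in> carrier R" and s: "s \<in> carrier R" and i: "i \<in> {1..n}" and j: "j \<in> {1..n}"
  shows "(\<Oplus>m\<in>{1..n}. delta_sum n R \<delta> T r i m \<otimes> delta_sum n R \<delta> T s m j)
    = nat_elt R n \<otimes> delta_sum n R \<delta> T (r \<otimes> s) i j"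
proof -
  let ?K = "{0..n - 1}"
  \<comment> \<open>\<open>a\<close> and \<open>b\<close> collect the factors that do not depend on
    \<open>m\<close>.\<close>
  define a where "a k = T 1 i [^] k \<otimes> (\<delta> ^^ k) r" for k :: nat
  define b where "b k = T j 1 [^] k \<otimes> (\<delta> ^^ k) s" for k :: nat
  have a: "a k \<in> carrier R" and b: "b k \<in> carrier R" for k
    using r s T_closed i j one_index by (auto simp: a_def b_def simp del: atLeastAtMost_iff)
  have Tc: "T m 1 \<in> carrier R" "T 1 m \<in> carrier R" if "m \<in> {1..n}" for m
    using T_closed one_index that by auto
  have left: "delta_sum n R \<delta> T r i m = (\<Oplus>k\<in>?K. T m 1 [^] k \<otimes> a k)" if m: "m \<in> {1..n}" for m
    unfolding delta_sum_def a_def using r T_closed[OF m i] Tc[OF m] Tc[OF i] T_pow_mult[OF m one_index i]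
    by (intro finsum_cong') (auto simp: m_assoc[symmetric])
  have right: "delta_sum n R \<delta> T s m j = (\<Oplus>l\<in>?K. T 1 m [^] l \<otimes> b l)" if m: "m \<in> {1..n}" for m
  proof -
    have "T j m [^] l = T 1 m [^] l \<otimes> T j 1 [^] l" for l :: nat
      using T_pow_mult[OF j one_index m] ring_center_comm[OF T_pow_center[OF one_index m]] Tc[OF j] by simp
    then show ?thesis
      unfolding delta_sum_def b_def using s Tc[OF m] Tc[OF j]
      by (intro finsum_cong') (auto simp: m_assoc)
  qed
  have "(\<Oplus>m\<in>{1..n}. delta_sum n R \<delta> T r i m \<otimes> delta_sum n R \<delta> T s m j)
      = (\<Oplus>m\<in>{1..n}. \<Oplus>k\<in>?K. \<Oplus>l\<in>?K. (T m 1 [^] k \<otimes> T 1 m [^] l) \<otimes> (a k \<otimes> b l))"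
  proof (rule finsum_cong')
    fix m assume m: "m \<in> {1..n}"
    have "delta_sum n R \<delta> T r i m \<otimes> delta_sum n R \<delta> T s m j =
        (\<Oplus>k\<in>?K. \<Oplus>l\<in>?K. (T m 1 [^] k \<otimes> a k) \<otimes> (T 1 m [^] l \<otimes> b l))"
      unfolding left[OF m] right[OF m] using Tc[OF m] a b
      by (subst finsum_ldistr) (auto intro!: finsum_closed finsum_cong' finsum_rdistr)
    also have "\<dots> = (\<Oplus>k\<in>?K. \<Oplus>l\<in>?K. (T m 1 [^] k \<otimes> T 1 m [^] l) \<otimes> (a k \<otimes> b l))"
      using Tc[OF m] a b
      by (intro finsum_cong') (auto simp: m_assoc ring_center_lcomm[OF T_pow_center[OF one_index m]]
          simp del: One_nat_def intro!: finsum_closed)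
    finally show "delta_sum n R \<delta> T r i m \<otimes> delta_sum n R \<delta> T s m j =
        (\<Oplus>k\<in>?K. \<Oplus>l\<in>?K. (T m 1 [^] k \<otimes> T 1 m [^] l) \<otimes> (a k \<otimes> b l))" .
  qed (use Tc a b in \<open>auto intro!: finsum_closed\<close>)
  \<comment> \<open>Two interchanges bring the sum over \<open>m\<close> innermost, where
    orthogonality applies.\<close>
  also have "\<dots> = (\<Oplus>k\<in>?K. \<Oplus>m\<in>{1..n}. \<Oplus>l\<in>?K. (T m 1 [^] k \<otimes> T 1 m [^] l) \<otimes> (a k \<otimes> b l))"
    using Tc a b by (intro finsum_swap) (auto intro!: finsum_closed)
  also have "\<dots> = (\<Oplus>k\<in>?K. \<Oplus>l\<in>?K. \<Oplus>m\<in>{1..n}. (T m 1 [^] k \<otimes> T 1 m [^] l) \<otimes> (a k \<otimes> b l))"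
    using Tc a b by (intro finsum_cong' finsum_swap) (auto intro!: finsum_closed)
  also have "\<dots> = (\<Oplus>k\<in>?K. \<Oplus>l\<in>?K. if k = l then nat_elt R n \<otimes> (a k \<otimes> b l) else \<zero>)"
  proof (intro finsum_cong')
    fix k l assume "k \<in> ?K" "l \<in> ?K"
    then have kl: "k < n" "l < n" using n_pos by auto
    have "(\<Oplus>m\<in>{1..n}. (T m 1 [^] k \<otimes> T 1 m [^] l) \<otimes> (a k \<otimes> b l))
        = (\<Oplus>m\<in>{1..n}. T m 1 [^] k \<otimes> T 1 m [^] l) \<otimes> (a k \<otimes> b l)"
      using Tc a b by (intro finsum_ldistr[symmetric]) auto
    then show "(\<Oplus>m\<in>{1..n}. (T m 1 [^] k \<otimes> T 1 m [^] l) \<otimes> (a k \<otimes> b l))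
        = (if k = l then nat_elt R n \<otimes> (a k \<otimes> b l) else \<zero>)"
      using a b T_orthogonal[OF kl] by (simp del: One_nat_def)
  qed (use a b in \<open>auto intro!: finsum_closed\<close>)
  also have "\<dots> = (\<Oplus>k\<in>?K. nat_elt R n \<otimes> (a k \<otimes> b k))"
    using a b by (intro finsum_cong' finsum_singleton) auto
  also have "\<dots> = (\<Oplus>k\<in>?K. nat_elt R n \<otimes> (T j i [^] k \<otimes> (\<delta> ^^ k) (r \<otimes> s)))"
  proof (rule finsum_cong')
    fix k assume "k \<in> ?K"
    \<comment> \<open>On the diagonal the outer factors recombine to \<open>T j i\<close>, and
      \<open>\<delta> ^^ k\<close> is multiplicative.\<close>
    have "a k \<otimes> b k = T j 1 [^] k \<otimes> (T 1 i [^] k \<otimes> ((\<delta> ^^ k) r \<otimes> (\<delta> ^^ k) s))"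
      unfolding a_def b_def using r s Tc[OF i] Tc[OF j]
      by (simp add: m_assoc ring_center_lcomm[OF T_pow_center[OF j one_index]] del: One_nat_def)
    also have "\<dots> = T j i [^] k \<otimes> (\<delta> ^^ k) (r \<otimes> s)"
      using r s T_closed[OF j i] Tc[OF i] Tc[OF j] T_pow_mult[OF j one_index i]
      by (simp add: m_assoc[symmetric] ring_hom_mult[OF endo_pow_hom])
    finally show "nat_elt R n \<otimes> (a k \<otimes> b k) = nat_elt R n \<otimes> (T j i [^] k \<otimes> (\<delta> ^^ k) (r \<otimes> s))"
      by simp
  qed (use r s T_closed[OF j i] in auto)
  also have "\<dots> = nat_elt R n \<otimes> delta_sum n R \<delta> T (r \<otimes> s) i j"
    unfolding delta_sum_def using r s T_closed[OF j i] by (intro finsum_rdistr[symmetric]) auto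
  finally show ?thesis .
qed

lemma delta_bar_mult:
  assumes "r \<in> carrier R" "s \<in> carrier R"
  shows "delta_bar n R \<delta> T (r \<otimes> s) = delta_bar n R \<delta> T r \<otimes>\<^bsub>mat_ring n R\<^esub> delta_bar n R \<delta> T s"
  unfolding delta_bar_def[of n R \<delta> T "r \<otimes> s"] mat_ring_simps
proof (rule mk_mat_cong)
  fix i j assume i: "i \<in> {1..n}" and j: "j \<in> {1..n}"
  have d: "delta_sum n R \<delta> T x k l \<in> carrier R"
    if "x \<in> carrier R" "k \<in> {1..n}" "l \<in> {1..n}" for x k l using that by (rule delta_sum_closed)
  have inv_n_interchange: "(inv_n \<otimes> x) \<otimes> (inv_n \<otimes> y) = (inv_n \<otimes> inv_n) \<otimes> (x \<otimes> y)"
    if "x \<in> carrier R" "y \<in> carrier R" for x y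
    using ring_center_lcomm[OF inv_n_center that] that by (simp add: m_assoc)
  have "(\<Oplus>m\<in>{1..n}. delta_bar n R \<delta> T r i m \<otimes> delta_bar n R \<delta> T s m j) =
      (\<Oplus>m\<in>{1..n}. (inv_n \<otimes> inv_n) \<otimes> (delta_sum n R \<delta> T r i m \<otimes> delta_sum n R \<delta> T s m j))"
    using assms d i j
    by (intro finsum_cong')
      (auto simp: delta_bar_apply inv_n_interchange simp del: atLeastAtMost_iff)
  also have "\<dots> = (inv_n \<otimes> inv_n) \<otimes> (\<Oplus>m\<in>{1..n}. delta_sum n R \<delta> T r i m \<otimes> delta_sum n R \<delta> T s m j)"
    using assms d i j by (intro finsum_rdistr[symmetric]) (auto simp del: atLeastAtMost_iff)
  \<comment> \<open>Each matrix contributes a factor 1/n; the factor \<open>n\<close> from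
    \<open>delta_sum_mult\<close> cancels one of the two.\<close>
  also have "\<dots> = inv_n \<otimes> (inv_n \<otimes> nat_elt R n) \<otimes> delta_sum n R \<delta> T (r \<otimes> s) i j"
    unfolding delta_sum_mult[OF assms i j] using assms d i j
      by (simp add: m_assoc del: atLeastAtMost_iff)
  finally show "inv_n \<otimes> delta_sum n R \<delta> T (r \<otimes> s) i j =
      (\<Oplus>m\<in>{1..n}. delta_bar n R \<delta> T r i m \<otimes> delta_bar n R \<delta> T s m j)"
    using n_unit by simp
qed

text \<open>In row 1 the coefficient of \<open>(\<delta> ^^ k) r\<close> is
  \<open>T j 1 [^] k\<close>, up to 1/n. Summed over \<open>j\<close> it vanishes for
  \<open>0 < k < n\<close> and equals \<open>n\<close> for \<open>k = 0\<close>, so an explicit left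
  inverse results.\<close>

lemma delta_bar_first_row_sum:
  assumes r: "r \<in> carrier R"
  shows "(\<Oplus>j\<in>{1..n}. delta_bar n R \<delta> T r 1 j) = r"
proof -
  let ?K = "{0..n - 1}"
  have Tc: "T j 1 \<in> carrier R" if "j \<in> {1..n}" for j using T_closed one_index that by auto
  have "(\<Oplus>j\<in>{1..n}. delta_bar n R \<delta> T r 1 j) = (\<Oplus>j\<in>{1..n}. inv_n \<otimes> delta_sum n R \<delta> T r 1 j)"
    using delta_sum_closed r one_index
      by (intro finsum_cong') (auto simp: delta_bar_apply simp del: atLeastAtMost_iff)
  also have "\<dots> = inv_n \<otimes> (\<Oplus>j\<in>{1..n}. delta_sum n R \<delta> T r 1 j)"
    using delta_sum_closed r one_index
      by (intro finsum_rdistr[symmetric]) (auto simp del: atLeastAtMost_iff)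
  also have "(\<Oplus>j\<in>{1..n}. delta_sum n R \<delta> T r 1 j) = (\<Oplus>k\<in>?K. \<Oplus>j\<in>{1..n}. T j 1 [^] k \<otimes> (\<delta> ^^ k) r)"
    unfolding delta_sum_def using r Tc by (intro finsum_swap) auto
  also have "\<dots> = (\<Oplus>k\<in>?K. if 0 = k then nat_elt R n \<otimes> (\<delta> ^^ k) r else \<zero>)"
  proof (rule finsum_cong')
    fix k assume k: "k \<in> ?K"
    have "(\<Oplus>j\<in>{1..n}. T j 1 [^] k \<otimes> (\<delta> ^^ k) r) = (\<Oplus>j\<in>{1..n}. T j 1 [^] k) \<otimes> (\<delta> ^^ k) r"
      using r Tc by (intro finsum_ldistr[symmetric]) auto
    moreover have "(\<Oplus>j\<in>{1..n}. T j 1 [^] k) = (if 0 = k then nat_elt R n else \<zero>)"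
      using pos_power_sum[of k] k n_pos by (auto simp: nat_elt_def add.finprod_const)
    ultimately show "(\<Oplus>j\<in>{1..n}. T j 1 [^] k \<otimes> (\<delta> ^^ k) r) =
        (if 0 = k then nat_elt R n \<otimes> (\<delta> ^^ k) r else \<zero>)"
      using r by simp
  qed (use r in auto)
  also have "\<dots> = nat_elt R n \<otimes> r"
    using finsum_singleton[of 0 ?K "\<lambda>k. nat_elt R n \<otimes> (\<delta> ^^ k) r"] r by auto
  finally show ?thesis using r n_unit by (simp add: m_assoc[symmetric])
qed

lemma delta_bar_inj_on: "inj_on (delta_bar n R \<delta> T) (carrier R)"
  by (rule inj_on_inverseI[where g = "\<lambda>A. \<Oplus>j\<in>{1..n}. A 1 j"]) (rule delta_bar_first_row_sum)

lemma delta_bar_embedding: "ring_embedding R (mat_ring n R) (delta_bar n R \<delta> T)"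
  unfolding ring_embedding_def
  by (intro conjI delta_bar_inj_on ring_hom_ringI ring_axioms mat_ring_is_ring delta_bar_closed
      delta_bar_mult delta_bar_add delta_bar_one)

end

section \<open>The supermatrix algebra: statement (3)\<close>

lemma endo_finsum: "f \<in> A \<rightarrow> carrier R \<Longrightarrow> \<delta> (finsum R f A) = (\<Oplus>a\<in>A. \<delta> (f a))"
  using endo.hom_finsum[of f A] by (simp add: comp_def)

text \<open>\<open>\<delta>\<close> fixes \<open>\<one>\<close>, hence its multiples, hence the
  inverse of \<open>nat_elt R n\<close> by uniqueness of inverses.\<close>

lemma endo_inv_n: "\<delta> inv_n = inv_n"
proof -
  have "\<delta> (nat_elt R k) = nat_elt R k" for k
    unfolding nat_elt_def by (induction k) simp_all
  then have "\<delta> inv_n \<otimes> nat_elt R n = \<one>"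
    using endo.hom_mult[of "inv_n" "nat_elt R n"] n_unit by simp
  then have "\<delta> inv_n \<otimes> (nat_elt R n \<otimes> inv_n) = inv_n"
    by (simp add: m_assoc[symmetric])
  then show ?thesis using n_unit by simp
qed

text \<open>For products, the central factor \<open>T k j\<close> passes \<open>A i k\<close> and
  meets \<open>T i k\<close>; their product \<open>T i j\<close> no longer depends on the summation
  index and can be pulled out.\<close>

lemma supermatrix_algebra_subring:
  "subring (carrier (supermatrix_algebra n R \<delta> T)) (mat_ring n R)"
proof -
  interpret M: ring "mat_ring n R" by (rule mat_ring_is_ring)
  note [simp] = mat_ring_entry_closed[of _ n R]
  have T_zero: "T i j \<otimes> \<zero> = \<zero>" if "i \<in> {1..n}" "j \<in> {1..n}" for i j using T_closed[OF that] by simp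
  show ?thesis
  proof (rule M.subringI)
    show "\<one>\<^bsub>mat_ring n R\<^esub> \<in> carrier (supermatrix_algebra n R \<delta> T)"
      using M.one_closed
        by (auto simp: supermatrix_algebra_def mat_ring_simps T_diag T_zero simp del: atLeastAtMost_iff)
    fix A assume "A \<in> carrier (supermatrix_algebra n R \<delta> T)"
    then have A: "A \<in> carrier (mat_ring n R)"
      and dA: "\<And>i j. \<lbrakk> i \<in> {1..n}; j \<in> {1..n} \<rbrakk> \<Longrightarrow> \<delta> (A i j) = T i j \<otimes> A i j"
      by (auto simp: supermatrix_algebra_def)
    have neg: "\<ominus>\<^bsub>mat_ring n R\<^esub> A = mk_mat n (\<lambda>i j. \<ominus> A i j)"
      using A by (intro M.minus_equality mk_mat_in_carrier)
        (auto simp: mat_ring_simps l_neg intro!: mk_mat_cong simp del: atLeastAtMost_iff)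
    show "\<ominus>\<^bsub>mat_ring n R\<^esub> A \<in> carrier (supermatrix_algebra n R \<delta> T)"
      using M.a_inv_closed[OF A] A dA T_closed unfolding neg
      by (auto simp: supermatrix_algebra_def r_minus simp del: atLeastAtMost_iff)
    fix B assume "B \<in> carrier (supermatrix_algebra n R \<delta> T)"
    then have B: "B \<in> carrier (mat_ring n R)"
      and dB: "\<And>i j. \<lbrakk> i \<in> {1..n}; j \<in> {1..n} \<rbrakk> \<Longrightarrow> \<delta> (B i j) = T i j \<otimes> B i j"
      by (auto simp: supermatrix_algebra_def)
    show "A \<oplus>\<^bsub>mat_ring n R\<^esub> B \<in> carrier (supermatrix_algebra n R \<delta> T)"
      using M.a_closed[OF A B] A B dA dB T_closed
      by (auto simp: supermatrix_algebra_def mat_ring_simps r_distr simp del: atLeastAtMost_iff)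
    have "\<delta> (\<Oplus>k\<in>{1..n}. A i k \<otimes> B k j) = T i j \<otimes> (\<Oplus>k\<in>{1..n}. A i k \<otimes> B k j)"
      if i: "i \<in> {1..n}" and j: "j \<in> {1..n}" for i j
    proof -
      have "\<delta> (\<Oplus>k\<in>{1..n}. A i k \<otimes> B k j) = (\<Oplus>k\<in>{1..n}. \<delta> (A i k \<otimes> B k j))"
        using A B i j by (intro endo_finsum) (auto simp del: atLeastAtMost_iff)
      also have "\<dots> = (\<Oplus>k\<in>{1..n}. T i j \<otimes> (A i k \<otimes> B k j))"
      proof (rule finsum_cong')
        fix k assume k: "k \<in> {1..n}"
        have "\<delta> (A i k \<otimes> B k j) = T i k \<otimes> (T k j \<otimes> (A i k \<otimes> B k j))"
          using A B i j k T_closed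
          by (simp add: dA dB m_assoc ring_center_lcomm[OF T_center[OF k j]] del: atLeastAtMost_iff)
        then show "\<delta> (A i k \<otimes> B k j) = T i j \<otimes> (A i k \<otimes> B k j)"
          using A B T_closed T_mult[OF i k j] i j k
            by (simp add: m_assoc[symmetric] del: atLeastAtMost_iff)
      qed (use A B i j T_closed in \<open>auto simp del: atLeastAtMost_iff\<close>)
      also have "\<dots> = T i j \<otimes> (\<Oplus>k\<in>{1..n}. A i k \<otimes> B k j)"
        using A B i j T_closed
          by (intro finsum_rdistr[symmetric]) (auto simp del: atLeastAtMost_iff)
      finally show ?thesis .
    qed
    then show "A \<otimes>\<^bsub>mat_ring n R\<^esub> B \<in> carrier (supermatrix_algebra n R \<delta> T)"
      using M.m_closed[OF A B]
      by (auto simp: supermatrix_algebra_def mat_ring_simps simp del: atLeastAtMost_iff)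
  qed (auto simp: supermatrix_algebra_def)
qed

lemma supermatrix_algebra_is_ring: "ring (supermatrix_algebra n R \<delta> T)"
  using ring.subring_is_ring[OF mat_ring_is_ring supermatrix_algebra_subring]
  by (simp add: supermatrix_algebra_def)

context
  assumes column_Fix: "\<And>i. i \<in> {1..n} \<Longrightarrow> T i 1 \<in> Fix R \<delta>"
    and column_pow_n: "\<And>i. i \<in> {1..n} \<Longrightarrow> T i 1 [^] n = \<one>"
    and endo_pow_n: "\<And>r. r \<in> carrier R \<Longrightarrow> (\<delta> ^^ n) r = r"
begin

text \<open>\<open>\<delta> (T 1 j)\<close> is an inverse of the fixed element \<open>T j 1\<close>,
  hence equals \<open>T 1 j\<close>; any other entry is a product of two fixed ones.\<close>

lemma endo_T:
  assumes i: "i \<in> {1..n}" and j: "j \<in> {1..n}"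
  shows "\<delta> (T i j) = T i j"
proof -
  have "T 1 j \<otimes> T j 1 = \<one>" "T j 1 \<otimes> T 1 j = \<one>" using T_mult T_diag one_index j by metis+
  then have "\<delta> (T 1 j) \<otimes> T j 1 = \<one>"
    using endo.hom_mult[OF T_closed[OF one_index j] T_closed[OF j one_index]] column_Fix[OF j]
    by (simp add: Fix_def)
  then have "\<delta> (T 1 j) = T 1 j"
    using T_closed[OF one_index j] T_closed[OF j one_index] \<open>T j 1 \<otimes> T 1 j = \<one>\<close>
    by (metis endo.hom_closed inv_unique)
  then show ?thesis
    using endo.hom_mult[OF T_closed[OF i one_index] T_closed[OF one_index j]] column_Fix[OF i]
      T_mult[OF i one_index j] by (simp add: Fix_def)
qed

lemma endo_delta_sum:
  assumes r: "r \<in> carrier R" and i: "i \<in> {1..n}" and j: "j \<in> {1..n}"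
  shows "\<delta> (delta_sum n R \<delta> T r i j) = T i j \<otimes> delta_sum n R \<delta> T r i j"
proof -
  define x where "x k = T j i [^] k \<otimes> (\<delta> ^^ k) r" for k
  have x: "x k \<in> carrier R" for k using r T_closed[OF j i] by (simp add: x_def)
  have sum: "delta_sum n R \<delta> T r i j = (\<Oplus>k\<in>{0..n - 1}. x k)"
    by (simp add: delta_sum_def x_def)
  \<comment> \<open>\<open>\<delta>\<close> raises the iterate but not the power of
    \<open>T j i\<close>; the missing factor is compensated by its inverse
    \<open>T i j\<close>.\<close>
  have shift: "\<delta> (x k) = T i j \<otimes> x (Suc k)" for k
  proof -
    have "T i j \<otimes> x (Suc k) = (T i j \<otimes> T j i) \<otimes> (T j i [^] k \<otimes> (\<delta> ^^ Suc k) r)"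
      unfolding x_def nat_pow_Suc2[OF T_closed[OF j i]] using r T_closed i j
      by (simp add: m_assoc del: atLeastAtMost_iff nat_pow_Suc)
    then show ?thesis
      using r T_closed T_mult[OF i j i] T_diag i endo_T[OF j i] j
      by (simp add: x_def endo.hom_nat_pow del: atLeastAtMost_iff)
  qed
  have wrap: "x n = x 0"
    using T_pow_n[OF column_pow_n j i] endo_pow_n[OF r] by (simp add: x_def)
  obtain m where m: "n = Suc m" using n_pos by (cases n) auto
  \<comment> \<open>Both sides are the sum of \<open>x\<close> over \<open>{..n}\<close>, with the
    first or the last term split off. By \<open>wrap\<close> these terms agree and cancel.\<close>
  have "(\<Oplus>k\<in>{..m}. x (Suc k)) \<oplus> x 0 = x n \<oplus> (\<Oplus>k\<in>{..m}. x k)"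
    using finsum_Suc2[of x m] finsum_Suc[of x m] x m by auto
  then have "(\<Oplus>k\<in>{..m}. x (Suc k)) = (\<Oplus>k\<in>{..m}. x k)"
    using x by (simp add: wrap a_comm[of _ "x 0"])
  then have "(\<Oplus>k\<in>{0..n - 1}. x (Suc k)) = (\<Oplus>k\<in>{0..n - 1}. x k)"
    by (simp add: m atLeast0AtMost)
  moreover have "\<delta> (\<Oplus>k\<in>{0..n - 1}. x k) = (\<Oplus>k\<in>{0..n - 1}. T i j \<otimes> x (Suc k))"
    using x by (subst endo_finsum) (auto simp: shift)
  moreover have "\<dots> = T i j \<otimes> (\<Oplus>k\<in>{0..n - 1}. x (Suc k))"
    using x T_closed[OF i j] by (intro finsum_rdistr[symmetric]) auto
  ultimately show ?thesis unfolding sum by simp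
qed

lemma delta_bar_supermatrix:
  assumes "r \<in> carrier R"
  shows "delta_bar n R \<delta> T r \<in> carrier (supermatrix_algebra n R \<delta> T)"
  using delta_bar_closed[OF assms] delta_sum_closed[OF assms] assms T_closed
  by (auto simp: supermatrix_algebra_def delta_bar_apply endo_delta_sum endo_inv_n
      ring_center_lcomm[OF inv_n_center]
      simp del: atLeastAtMost_iff)

text \<open>The operations are those of the full matrix ring, so (2) supplies the homomorphism and
  injectivity, and the cyclic shift only the range. The power sums matter: for
  \<open>\<delta>\<close> the identity and all entries of \<open>T\<close> equal to one, the image
  of \<open>\<one>\<close> is the all-ones matrix.\<close>

lemma delta_bar_supermatrix_embedding:
  assumes "power_sums_vanish n R T"
  shows "ring_embedding R (supermatrix_algebra n R \<delta> T) (delta_bar n R \<delta> T)"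
  unfolding ring_embedding_def
proof (intro conjI delta_bar_inj_on[OF assms] ring_hom_ringI ring_axioms supermatrix_algebra_is_ring
    delta_bar_supermatrix)
qed (simp_all add: supermatrix_algebra_def delta_bar_mult[OF assms] delta_bar_add delta_bar_one[OF assms])

end

end

theorem theorem3p2:
  fixes R :: "('a, 'm) ring_scheme" (structure)
    and n :: nat
    and \<delta> :: "'a \<Rightarrow> 'a"
    and T :: "nat \<Rightarrow> nat \<Rightarrow> 'a"
  assumes "ring R"
    and "1 \<le> n"
    and "nat_elt R n \<in> Units R"
    and "\<delta> \<in> ring_hom R R"
    and "transitive_mat n R T"
    and "\<forall>i \<in> {1..n}. T i 1 \<in> Units R \<inter> ring_center R"
  shows
    "(\<forall>r \<in> carrier R. \<forall>i \<in> {1..n}. \<forall>j \<in> {1..n}.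
        delta_sum n R \<delta> T r i j =
          (\<Oplus>k \<in> {0..n - 1}. ((inv (T i j)) [^] k) \<otimes> (\<delta> ^^ k) r))
     \<and> delta_bar n R \<delta> T \<in> carrier R \<rightarrow> carrier (mat_ring n R)
     \<and> (\<forall>r \<in> carrier R. \<forall>c \<in> Fix R \<delta>.
          delta_bar n R \<delta> T (c \<otimes> r) = mat_lmult n R c (delta_bar n R \<delta> T r) \<and>
          delta_bar n R \<delta> T (r \<otimes> c) = mat_rmult n R (delta_bar n R \<delta> T r) c)
     \<and> ((\<forall>i \<in> {1..n}. T i 1 [^] n = \<one>) \<and>
        (\<forall>i \<in> {1..n}. \<forall>j \<in> {1..n}. i \<noteq> j \<longrightarrow>
           non_zero_divisor (R \<lparr> carrier := ring_center R \<rparr>) (\<one> \<ominus> T i j))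
        \<longrightarrow> (\<forall>r \<in> Fix R \<delta>. delta_bar n R \<delta> T r = mat_lmult n R r \<one>\<^bsub>mat_ring n R\<^esub>))
     \<and> (power_sums_vanish n R T \<longrightarrow>
          ring_embedding R (mat_ring n R) (delta_bar n R \<delta> T))
     \<and> ((\<forall>i \<in> {1..n}. T i 1 \<in> Fix R \<delta> \<and> T i 1 [^] n = \<one>) \<and>
        (\<forall>r \<in> carrier R. (\<delta> ^^ n) r = r)
        \<longrightarrow> delta_bar n R \<delta> T \<in> carrier R \<rightarrow> carrier (supermatrix_algebra n R \<delta> T) \<and>
            (power_sums_vanish n R T \<longrightarrow>
               ring_embedding R (supermatrix_algebra n R \<delta> T) (delta_bar n R \<delta> T)))"
proof -
  interpret ring R by fact
  interpret transitive_matrix_endomorphism R n \<delta> T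
    using assms by unfold_locales auto
  show ?thesis
  proof (intro conjI impI ballI Pi_I; (elim conjE)?)
    fix r i j assume "r \<in> carrier R" "i \<in> {1..n}" "j \<in> {1..n}"
    then show "delta_sum n R \<delta> T r i j = (\<Oplus>k\<in>{0..n - 1}. inv (T i j) [^] k \<otimes> (\<delta> ^^ k) r)"
      by (rule delta_sum_inv)
  next
    fix r assume "\<forall>i\<in>{1..n}. T i 1 [^] n = \<one>" and r: "r \<in> Fix R \<delta>"
      and "\<forall>i\<in>{1..n}. \<forall>j\<in>{1..n}. i \<noteq> j \<longrightarrow>
        non_zero_divisor (R\<lparr>carrier := ring_center R\<rparr>) (\<one> \<ominus> T i j)"
    then show "delta_bar n R \<delta> T r = mat_lmult n R r \<one>\<^bsub>mat_ring n R\<^esub>"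
      by (intro delta_bar_Fix_scalar[OF r] T_pow_sum_eq_zero) auto
  next
    fix r assume "\<forall>i\<in>{1..n}. T i 1 \<in> Fix R \<delta> \<and> T i 1 [^] n = \<one>"
      "\<forall>r\<in>carrier R. (\<delta> ^^ n) r = r" "r \<in> carrier R"
    then show "delta_bar n R \<delta> T r \<in> carrier (supermatrix_algebra n R \<delta> T)"
      by (intro delta_bar_supermatrix) auto
  next
    assume "\<forall>i\<in>{1..n}. T i 1 \<in> Fix R \<delta> \<and> T i 1 [^] n = \<one>"
      "\<forall>r\<in>carrier R. (\<delta> ^^ n) r = r" "power_sums_vanish n R T"
    then show "ring_embedding R (supermatrix_algebra n R \<delta> T) (delta_bar n R \<delta> T)"
      by (intro delta_bar_supermatrix_embedding) auto
  qed (auto intro: delta_bar_closed delta_bar_lmult_Fix delta_bar_rmult_Fix delta_bar_embedding)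
qed

end
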